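(* Let $\lambda=0$ and $\delta=0$, let $k$ be a positive constant, and let $G:L^2(0,T)\to L^2(0,T;L^2(0,L))\times L^2(0,T;L^2(0,L))$ map a control $\psi$ to the state $(u,p)$ solving the one-dimensional poroelastic system $$H_e u_{xx}-p_x=0,\qquad u_{xt}-k p_{xx}=0\quad\text{in }[0,L]\times[0,T],$$ $$u(0,t)=p(0,t)=0,\quad -k p_x(L,t)=\psi(t),\quad H_e u_x(L,t)-p(L,t)=0\quad(t\in[0,T]),\qquad u_x(x,0)=0\quad(x\in[0,L]).$$ Let $j:L^2(0,T)\to\mathbb{R}$, $$j(\psi)=\tfrac12\|u-u_d\|_{L^2(0,T;L^2(0,L))}^2+\tfrac12\|p-p_d\|_{L^2(0,T;L^2(0,L))}^2,\qquad (u,p)=G\psi+(\tilde u,\tilde p).$$ Then $j$ is twice Fréchet differentiable and there is $C>0$ such that $$|\nabla^2 j(\psi)(\xi,\varphi)|\le C\|\xi\|_{L^1(0,T)}\|\varphi\|_{L^1(0,T)}\quad\text{for all }\psi,\xi,\varphi\in L^2(0,T).$$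
   Context: $T,L>0$; $H_e=\lambda_e+2\mu_e>0$ with $\lambda_e,\mu_e>0$. $u_d,p_d,\tilde u,\tilde p\in L^2(0,T;L^2(0,L))$ are fixed given functions ($(\tilde u,\tilde p)$ is the state produced by the remaining given data with zero control). Subscripts $x,t$ denote partial derivatives. For $\psi\in L^2(0,T)$ the state is the unique weak solution: with $V_0=\{v\in H^1(0,L):v(0)=0\}$, $u,p\in L^2(0,T;V_0)$ such that $\int_0^L(H_e u_x-p)v_x\,dx=0$ for all $v\in V_0$ and a.a. $t$, and $\int_0^T\left[-(u_x,q_t)_{L^2(0,L)}+k(p_x,q_x)_{L^2(0,L)}+\psi(t)q(L,t)\right]dt=0$ for all $q\in H^1(0,T;V_0)$ with $q(\cdot,T)=0$. This solution exists, is unique, and depends linearly and continuously on $\psi\in L^2(0,T)$ (known well-posedness). *)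

theory Defs
  imports "HOL-Analysis.Analysis"
begin

text \<open>Elements of Lebesgue spaces are represented by measurable functions; no quotient by
  almost-everywhere equality is taken, so \<open>L2_norm\<close> is a seminorm.\<close>

definition L2_space :: "'a measure \<Rightarrow> ('a \<Rightarrow> real) set" where
  "L2_space M = {f \<in> borel_measurable M. integrable M (\<lambda>x. (f x)\<^sup>2)}"

definition L2_norm :: "'a measure \<Rightarrow> ('a \<Rightarrow> real) \<Rightarrow> real" where
  "L2_norm M f = sqrt (LINT x|M. (f x)\<^sup>2)"

definition L1_norm :: "'a measure \<Rightarrow> ('a \<Rightarrow> real) \<Rightarrow> real" where
  "L1_norm M f = (LINT x|M. \<bar>f x\<bar>)"

definition segm :: "real \<Rightarrow> real measure" where
  "segm R = restrict_space lborel {0<..<R}"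

text \<open>The space-time cylinder \<open>(0,T) \<times> (0,L)\<close>, with time as the first coordinate.
  \<open>L\<^sup>2(0,T;L\<^sup>2(0,L))\<close> is identified with \<open>L\<^sup>2\<close> of this product
  (the two are isometric by Fubini's theorem).\<close>

definition cyl :: "real \<Rightarrow> real \<Rightarrow> (real \<times> real) measure" where
  "cyl T L = segm T \<Otimes>\<^sub>M segm L"


section \<open>Frechet derivatives of functionals on \<open>L\<^sup>2\<close>\<close>

text \<open>Since \<open>L\<^sup>2(M)\<close> is not a type, the library's \<open>has_derivative\<close> cannot be used for it.\<close>

definition L2_functional :: "'a measure \<Rightarrow> (('a \<Rightarrow> real) \<Rightarrow> real) \<Rightarrow> bool" where
  "L2_functional M D \<longleftrightarrow>
     (\<forall>f\<in>L2_space M. \<forall>g\<in>L2_space M. D (\<lambda>x. f x + g x) = D f + D g) \<and>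
     (\<forall>c. \<forall>f\<in>L2_space M. D (\<lambda>x. c * f x) = c * D f) \<and>
     (\<exists>B. \<forall>f\<in>L2_space M. \<bar>D f\<bar> \<le> B * L2_norm M f)"

definition L2_bilinear_form ::
    "'a measure \<Rightarrow> (('a \<Rightarrow> real) \<Rightarrow> ('a \<Rightarrow> real) \<Rightarrow> real) \<Rightarrow> bool" where
  "L2_bilinear_form M H \<longleftrightarrow>
     (\<forall>f\<in>L2_space M. L2_functional M (H f)) \<and>
     (\<forall>g\<in>L2_space M. L2_functional M (\<lambda>f. H f g)) \<and>
     (\<exists>B. \<forall>f\<in>L2_space M. \<forall>g\<in>L2_space M. \<bar>H f g\<bar> \<le> B * L2_norm M f * L2_norm M g)"

definition has_L2_derivative ::
    "'a measure \<Rightarrow> (('a \<Rightarrow> real) \<Rightarrow> real) \<Rightarrow> (('a \<Rightarrow> real) \<Rightarrow> real) \<Rightarrow> ('a \<Rightarrow> real) \<Rightarrow> bool" where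
  "has_L2_derivative M J D \<psi> \<longleftrightarrow>
     L2_functional M D \<and>
     (\<forall>e>0. \<exists>d>0. \<forall>h\<in>L2_space M. L2_norm M h < d \<longrightarrow>
        \<bar>J (\<lambda>x. \<psi> x + h x) - J \<psi> - D h\<bar> \<le> e * L2_norm M h)"

text \<open>\<open>D\<close> maps points of \<open>L\<^sup>2(M)\<close> to elements of the dual space. The quantification over \<open>g\<close>
  states that the dual norm of the remainder is at most \<open>e * L2_norm M h\<close>.\<close>

definition has_L2_derivative_dual ::
    "'a measure \<Rightarrow> (('a \<Rightarrow> real) \<Rightarrow> ('a \<Rightarrow> real) \<Rightarrow> real) \<Rightarrow>
     (('a \<Rightarrow> real) \<Rightarrow> ('a \<Rightarrow> real) \<Rightarrow> real) \<Rightarrow> ('a \<Rightarrow> real) \<Rightarrow> bool" where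
  "has_L2_derivative_dual M D H \<psi> \<longleftrightarrow>
     L2_bilinear_form M H \<and>
     (\<forall>e>0. \<exists>d>0. \<forall>h\<in>L2_space M. L2_norm M h < d \<longrightarrow>
        (\<forall>g\<in>L2_space M. \<bar>D (\<lambda>x. \<psi> x + h x) g - D \<psi> g - H h g\<bar> \<le> e * L2_norm M h * L2_norm M g))"

definition twice_L2_derivatives ::
    "'a measure \<Rightarrow> (('a \<Rightarrow> real) \<Rightarrow> real) \<Rightarrow> (('a \<Rightarrow> real) \<Rightarrow> ('a \<Rightarrow> real) \<Rightarrow> real) \<Rightarrow>
     (('a \<Rightarrow> real) \<Rightarrow> ('a \<Rightarrow> real) \<Rightarrow> ('a \<Rightarrow> real) \<Rightarrow> real) \<Rightarrow> bool" where
  "twice_L2_derivatives M J D H \<longleftrightarrow>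
     (\<forall>\<psi>\<in>L2_space M. has_L2_derivative M J (D \<psi>) \<psi> \<and> has_L2_derivative_dual M D (H \<psi>) \<psi>)"


section \<open>Sobolev spaces\<close>

text \<open>\<open>v \<in> H\<^sup>1(0,R)\<close> with weak derivative \<open>g\<close>. On an interval, \<open>C\<^sup>1\<close> test functions with compact
  support are enough (Brezis, Functional Analysis, Section 8.2).\<close>

definition H1_deriv :: "real \<Rightarrow> (real \<Rightarrow> real) \<Rightarrow> (real \<Rightarrow> real) \<Rightarrow> bool" where
  "H1_deriv R v g \<longleftrightarrow>
     v \<in> L2_space (segm R) \<and> g \<in> L2_space (segm R) \<and>
     (\<forall>\<phi>. \<phi> C1_differentiable_on UNIV \<and> (\<exists>a b. 0 < a \<and> b < R \<and> (\<forall>x. x \<notin> {a..b} \<longrightarrow> \<phi> x = 0)) \<longrightarrow>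
        (LINT x|segm R. v x * deriv \<phi> x) = - (LINT x|segm R. g x * \<phi> x))"

text \<open>\<open>v(a) = c\<close> for \<open>a \<in> {0,R}\<close>, in the sense of the continuous representative of \<open>v\<close>.\<close>

definition boundary_value :: "real \<Rightarrow> (real \<Rightarrow> real) \<Rightarrow> real \<Rightarrow> real \<Rightarrow> bool" where
  "boundary_value R v a c \<longleftrightarrow>
     (\<exists>w. continuous_on {0..R} w \<and> (AE x in segm R. v x = w x) \<and> w a = c)"

definition V0_deriv :: "real \<Rightarrow> (real \<Rightarrow> real) \<Rightarrow> (real \<Rightarrow> real) \<Rightarrow> bool" where
  "V0_deriv L v g \<longleftrightarrow> H1_deriv L v g \<and> boundary_value L v 0 0"

text \<open>\<open>u \<in> L\<^sup>2(0,T;V\<^sub>0)\<close> with \<open>u\<^sub>x = ux\<close>.\<close>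

definition L2_V0 :: "real \<Rightarrow> real \<Rightarrow> (real \<times> real \<Rightarrow> real) \<Rightarrow> (real \<times> real \<Rightarrow> real) \<Rightarrow> bool" where
  "L2_V0 T L u ux \<longleftrightarrow>
     u \<in> L2_space (cyl T L) \<and> ux \<in> L2_space (cyl T L) \<and>
     (AE t in segm T. V0_deriv L (\<lambda>x. u (t, x)) (\<lambda>x. ux (t, x)))"

text \<open>\<open>q \<in> H\<^sup>1(0,T;V\<^sub>0)\<close> with \<open>q\<^sub>x = qx\<close>, \<open>q\<^sub>t = qt\<close> and \<open>q(\<cdot>,T) = 0\<close>. As \<open>V\<^sub>0\<close> embeds into
  \<open>L\<^sup>2(0,L)\<close>, the vector-valued weak time derivative and the final value may be taken
  for almost every \<open>x\<close>.\<close>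

definition H1_V0_final_zero ::
    "real \<Rightarrow> real \<Rightarrow> (real \<times> real \<Rightarrow> real) \<Rightarrow> (real \<times> real \<Rightarrow> real) \<Rightarrow> (real \<times> real \<Rightarrow> real) \<Rightarrow> bool" where
  "H1_V0_final_zero T L q qx qt \<longleftrightarrow>
     L2_V0 T L q qx \<and> (\<exists>qtx. L2_V0 T L qt qtx) \<and>
     (AE x in segm L. H1_deriv T (\<lambda>t. q (t, x)) (\<lambda>t. qt (t, x)) \<and>
                      boundary_value T (\<lambda>t. q (t, x)) T 0)"


section \<open>State equation and cost\<close>

text \<open>In the second equation \<open>b\<close> is a measurable representative of \<open>t \<mapsto> q(L,t)\<close>.\<close>

definition weak_state ::
    "real \<Rightarrow> real \<Rightarrow> real \<Rightarrow> real \<Rightarrow> (real \<Rightarrow> real) \<Rightarrow> (real \<times> real \<Rightarrow> real) \<Rightarrow> (real \<times> real \<Rightarrow> real) \<Rightarrow> bool" where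
  "weak_state T L He k \<psi> u p \<longleftrightarrow>
     (\<exists>ux px. L2_V0 T L u ux \<and> L2_V0 T L p px \<and>
        (\<forall>v vx. V0_deriv L v vx \<longrightarrow>
           (AE t in segm T. (LINT x|segm L. (He * ux (t, x) - p (t, x)) * vx x) = 0)) \<and>
        (\<forall>q qx qt b. H1_V0_final_zero T L q qx qt \<and> b \<in> L2_space (segm T) \<and>
           (AE t in segm T. boundary_value L (\<lambda>x. q (t, x)) L (b t)) \<longrightarrow>
           (LINT t|segm T. - (LINT x|segm L. ux (t, x) * qt (t, x))
                           + k * (LINT x|segm L. px (t, x) * qx (t, x))
                           + \<psi> t * b t) = 0))"

definition cost ::
    "real \<Rightarrow> real \<Rightarrow> (real \<times> real \<Rightarrow> real) \<Rightarrow> (real \<times> real \<Rightarrow> real) \<Rightarrow>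
     (real \<times> real \<Rightarrow> real) \<Rightarrow> (real \<times> real \<Rightarrow> real) \<Rightarrow>
     ((real \<Rightarrow> real) \<Rightarrow> (real \<times> real \<Rightarrow> real) \<times> (real \<times> real \<Rightarrow> real)) \<Rightarrow> (real \<Rightarrow> real) \<Rightarrow> real" where
  "cost T L u_d p_d u_til p_til G \<psi> =
     (L2_norm (cyl T L) (\<lambda>z. fst (G \<psi>) z + u_til z - u_d z))\<^sup>2 / 2 +
     (L2_norm (cyl T L) (\<lambda>z. snd (G \<psi>) z + p_til z - p_d z))\<^sup>2 / 2"

end

(* The heart of the matter is the estimate ||p|| <= C * ||psi||_L1 for an arbitrary weak state.
   The elliptic equation gives H_e u_x = p, so the parabolic one reads p_t / H_e = k p_xx in weak
   form. It is tested with q(t,x) = int_t^tau p(s,x) ds for t < tau and q = 0 for t >= tau, so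
   that q_t = - p on t < tau. The first term becomes the integral of p^2 / H_e over t < tau, and
   the diffusion term is half the integral over x of the square of int_0^tau p_x ds, hence
   nonnegative. The boundary term is an integral of psi against differences of
   Phi(tau) = int_0^tau p(L,s) ds, and Phi(tau)^2 is controlled by the diffusion term; with
   M = sup |Phi| this gives M^2 <= (4 L / k) ||psi||_L1 M, and then the bound for p.
   Applied to psi = 0, the estimate yields uniqueness and hence linearity of G, so j is a
   quadratic functional whose second derivative is (xi, phi) |-> <G xi, G phi>. *)

theory Submission
  imports Defs
begin

section \<open>Square-integrable functions\<close>

text \<open>For an arbitrary weak state p is only square integrable in time, so p itself is not an
  admissible test function; its backward time integral is one, because its time derivative is minus
  p and it vanishes at the final time. The L1 norm of psi appears because the boundary term pairs
  psi with a bounded function of time. Cancelling a factor M requires M to be finite beforehand, and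
  this comes from p_x being integrable over the cylinder. The weak formulation involves test
  functions, continuous representatives and null sets that depend on the test function. A du
  Bois-Reymond argument replaces membership in V0 by the equation v(x) = integral of v_x over (0,x),
  almost everywhere. After that only indicator integrals, Fubini's theorem and the Cauchy-Schwarz
  inequality are involved. As states are functions rather than classes, G is linear only up to null
  sets.\<close>

lemma L2_spaceD:
  assumes "f \<in> L2_space M"
  shows "f \<in> borel_measurable M" and "integrable M (\<lambda>x. (f x)\<^sup>2)"
  using assms by (auto simp: L2_space_def)

lemma L2_spaceI:
  assumes [measurable]: "f \<in> borel_measurable M" and g: "integrable M g"
    and le: "AE x in M. (f x)\<^sup>2 \<le> g x"
  shows "f \<in> L2_space M"
proof -
  have "integrable M (\<lambda>x. (f x)\<^sup>2)"
  proof (rule Bochner_Integration.integrable_bound[OF g])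
    show "AE x in M. norm ((f x)\<^sup>2) \<le> norm (g x)"
      using le by eventually_elim (use zero_le_power2 order_trans in fastforce)
  qed simp
  then show ?thesis by (simp add: L2_space_def)
qed

lemma L2_space_mult_integrable:
  assumes f: "f \<in> L2_space M" and g: "g \<in> L2_space M"
  shows "integrable M (\<lambda>x. f x * g x)"
proof (rule Bochner_Integration.integrable_bound)
  note [measurable] = L2_spaceD(1)[OF f] L2_spaceD(1)[OF g]
  show "integrable M (\<lambda>x. (f x)\<^sup>2 + (g x)\<^sup>2)"
    using L2_spaceD(2)[OF f] L2_spaceD(2)[OF g] by simp
  show "(\<lambda>x. f x * g x) \<in> borel_measurable M" by measurable
  have "\<bar>a * b\<bar> \<le> a\<^sup>2 + b\<^sup>2" for a b :: real
    using sum_squares_bound[of a b] sum_squares_bound[of a "-b"]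
    by (auto simp: abs_if power2_eq_square)
  then show "AE x in M. norm (f x * g x) \<le> norm ((f x)\<^sup>2 + (g x)\<^sup>2)"
    by (auto intro!: AE_I2)
qed

lemma L2_space_cmult:
  assumes f: "f \<in> L2_space M"
  shows "(\<lambda>x. c * f x) \<in> L2_space M"
  using L2_spaceD[OF f] by (auto simp: L2_space_def power_mult_distrib)

lemma L2_space_add:
  assumes f: "f \<in> L2_space M" and g: "g \<in> L2_space M"
  shows "(\<lambda>x. f x + g x) \<in> L2_space M"
  using L2_spaceD[OF f] L2_spaceD[OF g] L2_space_mult_integrable[OF f g]
  by (auto simp: L2_space_def power2_sum mult.assoc intro!: Bochner_Integration.integrable_add)

lemma L2_space_diff:
  assumes f: "f \<in> L2_space M" and g: "g \<in> L2_space M"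
  shows "(\<lambda>x. f x - g x) \<in> L2_space M"
  using L2_space_add[OF f L2_space_cmult[OF g, of "-1"]] by simp

lemma L2_space_bounded_mult:
  assumes [measurable]: "h \<in> borel_measurable M" and h: "\<And>x. \<bar>h x\<bar> \<le> B" and f: "f \<in> L2_space M"
  shows "(\<lambda>x. h x * f x) \<in> L2_space M"
proof (rule L2_spaceI)
  note [measurable] = L2_spaceD(1)[OF f]
  show "(\<lambda>x. h x * f x) \<in> borel_measurable M" by measurable
  show "integrable M (\<lambda>x. B\<^sup>2 * (f x)\<^sup>2)" using L2_spaceD(2)[OF f] by simp
  have "(h x)\<^sup>2 \<le> B\<^sup>2" for x
    using h[of x] by (metis abs_ge_zero power2_abs power_mono)
  then show "AE x in M. (h x * f x)\<^sup>2 \<le> B\<^sup>2 * (f x)\<^sup>2"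
    by (auto simp: power_mult_distrib intro!: AE_I2 mult_right_mono)
qed

lemma (in finite_measure) L2_space_const: "(\<lambda>x. c) \<in> L2_space M"
  by (simp add: L2_space_def)

lemma (in finite_measure) L2_space_integrable:
  assumes "f \<in> L2_space M"
  shows "integrable M f"
  using L2_space_mult_integrable[OF L2_space_const[of 1] assms] by simp

lemma L2_norm_nonneg: "0 \<le> L2_norm M f"
  by (simp add: L2_norm_def)

lemma L2_norm_power2: "(L2_norm M f)\<^sup>2 = (LINT x|M. (f x)\<^sup>2)"
  by (simp add: L2_norm_def)

lemma L1_norm_nonneg: "0 \<le> L1_norm M f"
  by (simp add: L1_norm_def)

lemma L2_Cauchy_Schwarz:
  assumes f: "f \<in> L2_space M" and g: "g \<in> L2_space M"
  shows "\<bar>LINT x|M. f x * g x\<bar> \<le> L2_norm M f * L2_norm M g"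
proof -
  let ?a = "LINT x|M. (f x)\<^sup>2" and ?b = "LINT x|M. f x * g x" and ?c = "LINT x|M. (g x)\<^sup>2"
  note int = L2_spaceD(2)[OF f] L2_spaceD(2)[OF g] L2_space_mult_integrable[OF f g]
  \<comment> \<open>A form in the two variables \<open>s\<close> and \<open>r\<close>, so that both
    cases below are instances of it and nothing is divided by \<open>?c\<close>.\<close>
  have quad: "0 \<le> s\<^sup>2 * ?a - 2 * s * r * ?b + r\<^sup>2 * ?c" for s r
  proof -
    have "0 \<le> (LINT x|M. (s * f x - r * g x)\<^sup>2)" by simp
    also have "(\<lambda>x. (s * f x - r * g x)\<^sup>2) =
        (\<lambda>x. s\<^sup>2 * (f x)\<^sup>2 - 2 * s * r * (f x * g x) + r\<^sup>2 * (g x)\<^sup>2)"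
      by (auto simp: power2_eq_square algebra_simps)
    finally show ?thesis using int by simp
  qed
  have ac: "0 \<le> ?a" "0 \<le> ?c" by simp_all
  have "?b\<^sup>2 \<le> ?a * ?c"
  proof (cases "?c = 0")
    case True
    have "?b = 0"
    proof (rule ccontr)
      assume "?b \<noteq> 0"
      \<comment> \<open>With \<open>s = 1\<close> and this value of \<open>r\<close> the form equals
        \<open>?a - (?a + 1) = -1\<close>.\<close>
      then have "2 * ((?a + 1) / (2 * ?b)) * ?b = ?a + 1" by simp
      with quad[of 1 "(?a + 1) / (2 * ?b)"] True show False by simp
    qed
    with True show ?thesis by simp
  next
    case False
    with ac have "0 < ?c" by linarith
    have "0 \<le> ?c * (?a * ?c - ?b\<^sup>2)"
      using quad[of ?c ?b] by (simp add: power2_eq_square algebra_simps)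
    with \<open>0 < ?c\<close> show ?thesis by (simp add: zero_le_mult_iff)
  qed
  then have "sqrt (?b\<^sup>2) \<le> sqrt (?a * ?c)" by (rule real_sqrt_le_mono)
  then show ?thesis by (simp add: L2_norm_def real_sqrt_mult)
qed

lemma L2_Cauchy_Schwarz_power2:
  assumes f: "f \<in> L2_space M" and g: "g \<in> L2_space M"
  shows "(LINT x|M. f x * g x)\<^sup>2 \<le> (LINT x|M. (f x)\<^sup>2) * (LINT x|M. (g x)\<^sup>2)"
  using power_mono[OF L2_Cauchy_Schwarz[OF f g] abs_ge_zero, of 2]
  by (simp add: power_mult_distrib L2_norm_power2)

lemma (in finite_measure) L2_integral_power2_le:
  assumes f: "f \<in> L2_space M"
  shows "(LINT x|M. f x)\<^sup>2 \<le> measure M (space M) * (LINT x|M. (f x)\<^sup>2)"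
  using L2_Cauchy_Schwarz_power2[OF L2_space_const[of 1] f] by simp

text \<open>Converts estimates in the L1 norm of the control into the L2 boundedness that the
  notions of derivative demand.\<close>

lemma (in finite_measure) L1_norm_le_L2_norm:
  assumes f: "f \<in> L2_space M"
  shows "L1_norm M f \<le> sqrt (measure M (space M)) * L2_norm M f"
proof -
  have "(\<lambda>x. \<bar>f x\<bar>) \<in> L2_space M" using L2_spaceD[OF f] by (simp add: L2_space_def)
  from L2_Cauchy_Schwarz[OF L2_space_const[of 1] this] show ?thesis
    by (simp add: L1_norm_def L2_norm_def)
qed

section \<open>The interval measure and primitives\<close>

lemma space_segm [simp]: "space (segm R) = {0<..<R}"
  by (simp add: segm_def space_restrict_space)

lemma finite_measure_segm: "finite_measure (segm R)"
proof (rule finite_measureI)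
  have "emeasure (segm R) (space (segm R)) = emeasure lborel {0<..<R}"
    by (simp add: segm_def emeasure_restrict_space space_restrict_space)
  also have "\<dots> \<noteq> \<infinity>" by (cases "0 \<le> R") simp_all
  finally show "emeasure (segm R) (space (segm R)) \<noteq> \<infinity>" .
qed

lemma measure_segm [simp]: "0 \<le> R \<Longrightarrow> measure (segm R) {0<..<R} = R"
  by (simp add: segm_def measure_restrict_space)

lemma measurable_segm_id [measurable]: "(\<lambda>x. x) \<in> borel_measurable (segm R)"
  unfolding segm_def by (rule measurable_restrict_space1) simp

lemma borel_measurable_segm: "f \<in> borel_measurable borel \<Longrightarrow> f \<in> borel_measurable (segm R)"
  unfolding segm_def by (rule measurable_restrict_space1) simp

lemma measurable_segm_fst [measurable]: "fst \<in> borel_measurable (segm R \<Otimes>\<^sub>M N)"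
  using measurable_compose[OF measurable_fst measurable_segm_id] by simp

lemma measurable_segm_snd [measurable]: "snd \<in> borel_measurable (N \<Otimes>\<^sub>M segm R)"
  using measurable_compose[OF measurable_snd measurable_segm_id] by simp

lemma pair_sigma_finite_segm: "pair_sigma_finite (segm T) (segm L)"
  by (simp add: pair_sigma_finite_def finite_measure_segm
      finite_measure.axioms(1))

interpretation segm: finite_measure "segm R" for R by (rule finite_measure_segm)
interpretation segm2: pair_sigma_finite "segm T" "segm L" for T L by (rule pair_sigma_finite_segm)

lemma finite_measure_cyl: "finite_measure (cyl T L)"
  unfolding cyl_def by (rule finite_measure_pair_measure[OF finite_measure_segm finite_measure_segm])

interpretation cyl: finite_measure "cyl T L" for T L by (rule finite_measure_cyl)

lemma AE_segm_iff: "(AE x in segm R. P x) \<longleftrightarrow> (AE x in lborel. x \<in> {0<..<R} \<longrightarrow> P x)"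
  unfolding segm_def by (subst AE_restrict_space_iff) auto

lemma AE_segm_neq: "AE x in segm R. x \<noteq> c"
  unfolding AE_segm_iff using AE_lborel_singleton[of c] by eventually_elim simp

lemma integral_segm:
  "(LINT x|segm R. f x) = (LINT x|lborel. indicat_real {0<..<R} x * (f x :: real))"
  unfolding segm_def by (subst integral_restrict_space) auto

section \<open>Functions determined by their integrals over initial intervals\<close>

lemma integrable_indicator_mult:
  assumes f: "integrable M f" and [measurable]: "(\<lambda>x. x) \<in> borel_measurable M" "B \<in> sets borel"
  shows "integrable M (\<lambda>x. indicat_real B x * (f x :: real))"
proof (rule Bochner_Integration.integrable_bound[OF f])
  note [measurable] = borel_measurable_integrable[OF f]
  show "(\<lambda>x. indicat_real B x * f x) \<in> borel_measurable M" by measurable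
qed (auto simp: indicator_def)

text \<open>Initial intervals are stable under intersection and generate the Borel sets, so the
  integral of \<open>f\<close> vanishes over every Borel set. Only rational end points are demanded:
  in the elliptic equation each test has its own null set of times, and countably many of these
  still form a null set.\<close>

lemma AE_segm_zero:
  assumes f: "integrable (segm R) f"
    and zero: "\<And>b. b \<in> \<rat> \<Longrightarrow> 0 < b \<Longrightarrow> b < R \<Longrightarrow> (LINT x|segm R. indicat_real {..<b} x * f x) = 0"
  shows "AE x in segm R. f x = (0::real)"
proof (cases "0 < R")
  case False
  then show ?thesis by (simp add: AE_segm_iff)
next
  case R: True
  note [measurable] = borel_measurable_integrable[OF f]
  have real_end: "(LINT x|segm R. indicat_real {..<b} x * f x) = 0" if b: "0 < b" "b \<le> R" for b
  proof -
    \<comment> \<open>Approaching \<open>b\<close> strictly from below makes the indicators of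
      \<open>{..<r n}\<close> converge to that of \<open>{..<b}\<close> at every point; the bound
      \<open>b / 2\<close> keeps the rational end points positive.\<close>
    have "\<exists>r\<in>\<rat>. max (b / 2) (b - 1 / Suc n) < r \<and> r < b" for n
      by (rule Rats_dense_in_real) (use b in auto)
    then obtain r where r: "\<And>n. r n \<in> \<rat>" "\<And>n. b - 1 / Suc n < r n" "\<And>n. r n < b" "\<And>n. b / 2 < r n"
      by (metis max_less_iff_conj)
    have "(\<lambda>n. LINT x|segm R. indicat_real {..<r n} x * f x)
        \<longlonglongrightarrow> (LINT x|segm R. indicat_real {..<b} x * f x)"
    proof (rule integral_dominated_convergence[where w="\<lambda>x. \<bar>f x\<bar>"])
      show "AE x in segm R. (\<lambda>n. indicat_real {..<r n} x * f x) \<longlonglongrightarrow> indicat_real {..<b} x * f x"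
      proof (rule AE_I2)
        fix x
        have lim: "(\<lambda>n. b - 1 / real (Suc n)) \<longlonglongrightarrow> b - 0"
          by (intro tendsto_intros LIMSEQ_Suc lim_1_over_n)
        have "\<forall>\<^sub>F n in sequentially. indicat_real {..<r n} x = indicat_real {..<b} x"
        proof (cases "x < b")
          case True
          have "\<forall>\<^sub>F n in sequentially. x < b - 1 / real (Suc n)"
            by (rule order_tendstoD(1)[OF lim]) (use True in simp)
          then show ?thesis
            by eventually_elim (use True r(2) in \<open>auto simp: indicator_def intro: less_trans\<close>)
        next
          case False
          then show ?thesis
            using r(3) by (intro always_eventually) (auto simp: indicator_def intro: less_trans)
        qed
        then have "\<forall>\<^sub>F n in sequentially. indicat_real {..<r n} x * f x = indicat_real {..<b} x * f x"
          by eventually_elim simp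
        then show "(\<lambda>n. indicat_real {..<r n} x * f x) \<longlonglongrightarrow> indicat_real {..<b} x * f x"
          by (rule tendsto_eventually)
      qed
    qed (use f in \<open>auto simp: indicator_def\<close>)
    moreover have "(LINT x|segm R. indicat_real {..<r n} x * f x) = 0" for n
      by (rule zero) (use r[of n] b in auto)
    ultimately show ?thesis by (simp add: LIMSEQ_const_iff)
  qed
  have ray: "(LINT x|segm R. indicat_real {..<b} x * f x) = 0" for b
  proof -
    consider "b \<le> 0" | "0 < b" "b \<le> R" | "R < b" by linarith
    then show ?thesis
    proof cases
      case 1
      then have "(LINT x|segm R. indicat_real {..<b} x * f x) = (LINT x|segm R. 0)"
        by (intro Bochner_Integration.integral_cong) (auto simp: indicator_def)
      then show ?thesis by simp
    next
      case 3
      then have "(LINT x|segm R. indicat_real {..<b} x * f x) = (LINT x|segm R. indicat_real {..<R} x * f x)"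
        by (intro Bochner_Integration.integral_cong) (auto simp: indicator_def)
      then show ?thesis using real_end R by simp
    qed (rule real_end)
  qed
  have total: "(LINT x|segm R. f x) = 0"
  proof -
    have "(LINT x|segm R. indicat_real {..<R} x * f x) = (LINT x|segm R. f x)"
      by (intro Bochner_Integration.integral_cong) (auto simp: indicator_def)
    with ray show ?thesis by metis
  qed
  note int = integrable_indicator_mult[OF f measurable_segm_id]
  \<comment> \<open>Dynkin argument: complements are covered by \<open>total\<close>, disjoint
    unions by finite additivity and dominated convergence.\<close>
  have borel_zero: "(LINT x|segm R. indicat_real B x * f x) = 0" if "B \<in> sets borel" for B
  proof -
    have borel: "sets borel = sigma_sets UNIV (range (lessThan :: real \<Rightarrow> real set))"
      by (subst borel_Iio) simp
    have "{..<a} \<inter> {..<b} = {..<min a b}" for a b :: real by auto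
    then have "Int_stable (range (lessThan :: real \<Rightarrow> real set))" by (auto simp: Int_stable_def)
    moreover have "range (lessThan :: real \<Rightarrow> real set) \<subseteq> Pow UNIV" by simp
    moreover have "B \<in> sigma_sets UNIV (range (lessThan :: real \<Rightarrow> real set))"
      using that borel by simp
    ultimately show ?thesis
    proof (induction rule: sigma_sets_induct_disjoint)
      case (basic A)
      then show ?case using ray by auto
    next
      case empty
      then show ?case by simp
    next
      case (compl A)
      then have [measurable]: "A \<in> sets borel" by (simp add: borel)
      have "(\<lambda>x. indicat_real (UNIV - A) x * f x) = (\<lambda>x. f x - indicat_real A x * f x)"
        by (auto simp: indicator_def)
      then show ?case using f int[of A] total compl by simp
    next
      case (union A)
      then have [measurable]: "A i \<in> sets borel" for i by (auto simp: borel)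
      have "(\<lambda>i. LINT x|segm R. indicat_real (\<Union>j<i. A j) x * f x)
          \<longlonglongrightarrow> (LINT x|segm R. indicat_real (\<Union>i. A i) x * f x)"
      proof (rule integral_dominated_convergence[where w="\<lambda>x. \<bar>f x\<bar>"])
        show "AE x in segm R. (\<lambda>i. indicat_real (\<Union>j<i. A j) x * f x)
            \<longlonglongrightarrow> indicat_real (\<Union>i. A i) x * f x"
          by (intro AE_I2 tendsto_mult tendsto_const LIMSEQ_indicator_UN)
      qed (use f in \<open>auto simp: indicator_def\<close>)
      moreover have "(LINT x|segm R. indicat_real (\<Union>j<i. A j) x * f x) = 0" for i
      proof (induction i)
        case (Suc i)
        have "indicat_real (\<Union>j<Suc i. A j) x = indicat_real (\<Union>j<i. A j) x + indicat_real (A i) x" for x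
        proof -
          have "A i \<inter> A j = {}" if "j < i" for j
            using union.hyps(1) that by (auto simp: disjoint_family_on_def)
          then show ?thesis by (auto simp: indicator_def less_Suc_eq)
        qed
        then show ?case
          using Suc union.IH int by (simp add: distrib_right)
      qed simp
      ultimately show ?case by (simp add: LIMSEQ_const_iff)
    qed
  qed
  show ?thesis
  proof (rule segm.density_zero[OF f])
    fix A assume "A \<in> sets (segm R)"
    then have "A \<in> sets borel" by (auto simp: segm_def sets_restrict_space)
    with borel_zero show "set_lebesgue_integral (segm R) A f = 0"
      by (simp add: set_lebesgue_integral_def)
  qed
qed

text \<open>Two continuous functions that differ at an interior point differ on a ball of positive
  measure; the end points follow by passing to the closure. This makes boundary values independent
  of the chosen continuous representative.\<close>

lemma AE_eq_imp_eq:
  assumes w: "continuous_on {0..R} w" and z: "continuous_on {0..R} z"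
    and eq: "AE x in segm R. w x = (z x :: real)" and R: "0 < R" and a: "a \<in> {0..R}"
  shows "w a = z a"
proof -
  have inner: "w x - z x = 0" if x: "x \<in> {0<..<R}" for x
  proof (rule ccontr)
    assume neq: "w x - z x \<noteq> 0"
    have "continuous_on {0<..<R} (\<lambda>x. w x - z x)"
      by (intro continuous_on_diff continuous_on_subset[OF w] continuous_on_subset[OF z]) auto
    then have "open ((\<lambda>x. w x - z x) -` (- {0}) \<inter> {0<..<R})"
      by (subst (asm) continuous_on_open_vimage) auto
    moreover have "x \<in> (\<lambda>x. w x - z x) -` (- {0}) \<inter> {0<..<R}" using x neq by auto
    ultimately obtain e where e: "0 < e" "ball x e \<subseteq> (\<lambda>x. w x - z x) -` (- {0}) \<inter> {0<..<R}"
      by (metis open_contains_ball)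
    have "AE y in lborel. y \<notin> ball x e"
      using eq unfolding AE_segm_iff
      by eventually_elim (use e in \<open>force\<close>)
    then have "emeasure lborel {y \<in> space lborel. y \<in> ball x e} = 0"
      by (rule emeasure_eq_0_AE)
    moreover have "{y \<in> space lborel. y \<in> ball x e} = {x - e<..<x + e}"
      by (auto simp: dist_real_def)
    ultimately have "emeasure lborel {x - e<..<x + e} = 0" by simp
    with e show False by simp
  qed
  have "w a - z a = 0"
  proof (rule continuous_constant_on_closure[where f="\<lambda>x. w x - z x" and S="{0<..<R}"])
    show "continuous_on (closure {0<..<R}) (\<lambda>x. w x - z x)"
      using R w z by (simp add: continuous_on_diff)
  qed (use inner R a in auto)
  then show ?thesis by simp
qed

text \<open>The indicator inside \<open>segm R\<close> makes the primitive total: it is 0 for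
  \<open>x \<le> 0\<close> and constant from \<open>R\<close> on. In this form Fubini's theorem
  applies to it directly.\<close>

definition prim :: "real \<Rightarrow> (real \<Rightarrow> real) \<Rightarrow> real \<Rightarrow> real" where
  "prim R g x = (LINT y|segm R. indicat_real {..<x} y * g y)"

lemma prim_lincomb:
  assumes "integrable (segm R) g" and "integrable (segm R) h"
  shows "prim R (\<lambda>y. a * g y + b * h y) x = a * prim R g x + b * prim R h x"
  using integrable_indicator_mult[OF assms(1) measurable_segm_id, of "{..<x}"]
    integrable_indicator_mult[OF assms(2) measurable_segm_id, of "{..<x}"]
  by (simp add: prim_def algebra_simps)

lemma prim_0: "x \<le> 0 \<Longrightarrow> prim R g x = 0"
proof -
  assume "x \<le> 0"
  then have "prim R g x = (LINT y|segm R. 0)"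
    unfolding prim_def by (intro Bochner_Integration.integral_cong) (auto simp: indicator_def)
  then show ?thesis by simp
qed

lemma prim_right: "R \<le> x \<Longrightarrow> prim R g x = (LINT y|segm R. g y)"
  unfolding prim_def by (intro Bochner_Integration.integral_cong) (auto simp: indicator_def)

lemma continuous_on_prim:
  assumes g: "integrable (segm R) g"
  shows "continuous_on S (prim R g)"
proof -
  note [measurable] = borel_measurable_integrable[OF g]
  have "isCont (prim R g) x" for x
    unfolding continuous_at_sequentially comp_def prim_def
  proof (intro allI impI)
    fix r :: "nat \<Rightarrow> real" assume r: "r \<longlonglongrightarrow> x"
    show "(\<lambda>n. LINT y|segm R. indicat_real {..<r n} y * g y) \<longlonglongrightarrow> (LINT y|segm R. indicat_real {..<x} y * g y)"
    proof (rule integral_dominated_convergence[where w="\<lambda>x. \<bar>g x\<bar>"])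
      show "AE y in segm R. (\<lambda>n. indicat_real {..<r n} y * g y) \<longlonglongrightarrow> indicat_real {..<x} y * g y"
        \<comment> \<open>At \<open>y = x\<close> the indicators can oscillate when \<open>r\<close>
          approaches \<open>x\<close> from both sides; a single point is null.\<close>
        using AE_segm_neq[of x]
      proof eventually_elim
        fix y assume "y \<noteq> x"
        then consider "y < x" | "x < y" by linarith
        then have "\<forall>\<^sub>F n in sequentially. indicat_real {..<r n} y * g y = indicat_real {..<x} y * g y"
        proof cases
          case 1
          from order_tendstoD(1)[OF r 1] show ?thesis
            by eventually_elim (use 1 in \<open>auto simp: indicator_def\<close>)
        next
          case 2
          from order_tendstoD(2)[OF r 2] show ?thesis
            by eventually_elim (use 2 in \<open>auto simp: indicator_def\<close>)
        qed
        then show "(\<lambda>n. indicat_real {..<r n} y * g y) \<longlonglongrightarrow> indicat_real {..<x} y * g y"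
          by (rule tendsto_eventually)
      qed
    qed (use g in \<open>auto simp: indicator_def\<close>)
  qed
  then show ?thesis by (simp add: continuous_at_imp_continuous_on)
qed

lemma borel_measurable_prim [measurable]:
  assumes "integrable (segm R) g"
  shows "prim R g \<in> borel_measurable (segm S)"
  by (rule borel_measurable_segm[OF borel_measurable_continuous_onI]) (rule continuous_on_prim[OF assms])

text \<open>Cauchy-Schwarz against the indicator. The bound is uniform in \<open>x\<close>, and
  integrating it once more gives the Poincare inequality.\<close>

lemma prim_power2_le:
  assumes g: "g \<in> L2_space (segm R)" and R: "0 \<le> R"
  shows "(prim R g x)\<^sup>2 \<le> R * (LINT y|segm R. (g y)\<^sup>2)"
proof -
  have i: "(\<lambda>y. indicat_real {..<x} y) \<in> borel_measurable (segm R)" by measurable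
  have ig: "(\<lambda>y. indicat_real {..<x} y * g y) \<in> L2_space (segm R)"
    by (rule L2_space_bounded_mult[OF i _ g, of 1]) (auto simp: indicator_def)
  have "(prim R g x)\<^sup>2 \<le> R * (LINT y|segm R. (indicat_real {..<x} y * g y)\<^sup>2)"
    unfolding prim_def using segm.L2_integral_power2_le[OF ig] R by simp
  also have "\<dots> \<le> R * (LINT y|segm R. (g y)\<^sup>2)"
    using L2_spaceD(2)[OF ig] L2_spaceD(2)[OF g] R
    by (intro mult_left_mono integral_mono) (auto simp: indicator_def)
  finally show ?thesis .
qed

lemma prim_L2_space:
  assumes g: "g \<in> L2_space (segm R)" and R: "0 \<le> R"
  shows "prim R g \<in> L2_space (segm R)"
  by (rule L2_spaceI[where g="\<lambda>_. R * (LINT y|segm R. (g y)\<^sup>2)"])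
    (use prim_power2_le[OF g R] segm.L2_space_integrable[OF g] in \<open>auto intro: borel_measurable_prim\<close>)

section \<open>The one-dimensional Sobolev space\<close>

text \<open>The vanishing integral is what makes the antiderivative that starts at \<open>a\<close>
  return to zero at \<open>b\<close>, so that it is a test function.\<close>

lemma ex_C1_antiderivative:
  fixes h :: "real \<Rightarrow> real"
  assumes cont: "continuous_on UNIV h" and supp: "\<And>x. x \<notin> {a..b} \<Longrightarrow> h x = 0"
    and ab: "a \<le> b" and zero: "(LINT x|lborel. h x) = 0"
  obtains \<phi> where "\<phi> C1_differentiable_on UNIV" "\<And>x. x \<notin> {a..b} \<Longrightarrow> \<phi> x = 0" "deriv \<phi> = h"
proof -
  have "\<exists>F. \<forall>x::real. -\<infinity> < ereal x \<longrightarrow> ereal x < \<infinity> \<longrightarrow> (F has_vector_derivative h x) (at x)"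
    by (rule einterval_antiderivative) (use cont in \<open>auto simp: continuous_on_eq_continuous_at\<close>)
  then obtain F where F: "\<And>x. (F has_vector_derivative h x) (at x)" by auto
  define \<phi> where "\<phi> x = F x - F a" for x
  have \<phi>: "(\<phi> has_vector_derivative h x) (at x)" for x
    unfolding \<phi>_def using F[of x] by (auto intro!: derivative_eq_intros)
  have seg: "\<phi> y - \<phi> x = (LINT z|lborel. indicat_real {x..y} z *\<^sub>R h z)" if "x \<le> y" for x y
    by (rule integral_FTC_atLeastAtMost[symmetric])
      (use that \<phi> cont in \<open>auto intro: has_vector_derivative_at_within continuous_on_subset\<close>)
  have \<phi>a: "\<phi> a = 0" by (simp add: \<phi>_def)
  have left: "\<phi> x = 0" if "x < a" for x
  proof -
    have "(\<lambda>z. indicat_real {x..a} z *\<^sub>R h z) = (\<lambda>z. indicat_real {a} z *\<^sub>R h z)"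
    proof
      fix z show "indicat_real {x..a} z *\<^sub>R h z = indicat_real {a} z *\<^sub>R h z"
        using supp[of z] that by (cases "z < a") (auto simp: indicator_def)
    qed
    then show ?thesis using seg[of x a] seg[of a a] that \<phi>a by (simp add: indicator_def)
  qed
  have right: "\<phi> x = 0" if "b < x" for x
  proof -
    have "(\<lambda>z. indicat_real {a..x} z *\<^sub>R h z) = h"
    proof
      fix z show "indicat_real {a..x} z *\<^sub>R h z = h z"
        using supp[of z] that ab by (cases "z \<in> {a..x}") (auto simp: indicator_def)
    qed
    then show ?thesis using seg[of a x] that \<phi>a zero ab by simp
  qed
  show ?thesis
  proof (rule that)
    show "\<phi> C1_differentiable_on UNIV"
      unfolding C1_differentiable_on_def using \<phi> cont by blast
    show "\<phi> x = 0" if "x \<notin> {a..b}" for x using left right that by force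
    show "deriv \<phi> = h"
      using \<phi> by (auto intro!: DERIV_imp_deriv simp: has_real_derivative_iff_has_vector_derivative)
  qed
qed

text \<open>A trapezoid with slopes \<open>n\<close> that approximates the indicator of the open
  interval from below. Continuity suffices, because tents are used as derivatives of C1 test
  functions.\<close>

definition tent :: "real \<Rightarrow> real \<Rightarrow> nat \<Rightarrow> real \<Rightarrow> real" where
  "tent a b n x = max 0 (min 1 (n * min (x - a) (b - x)))"

lemma tent_bounds: "0 \<le> tent a b n x" "tent a b n x \<le> 1"
  by (auto simp: tent_def)

lemma tent_outside:
  assumes "x \<notin> {a<..<b}"
  shows "tent a b n x = 0"
proof -
  have "real n * min (x - a) (b - x) \<le> 0"
    using assms by (intro mult_nonneg_nonpos) auto
  then show ?thesis by (simp add: tent_def)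
qed

lemma continuous_on_tent: "continuous_on S (tent a b n)"
  unfolding tent_def by (intro continuous_intros)

lemma tent_tendsto: "(\<lambda>n. tent a b n x) \<longlonglongrightarrow> indicat_real {a<..<b} x"
proof (cases "x \<in> {a<..<b}")
  case True
  define c where "c = min (x - a) (b - x)"
  have c: "0 < c" using True by (auto simp: c_def)
  have "\<forall>\<^sub>F n in sequentially. 1 / c \<le> real n"
    using filterlim_real_sequentially by (simp add: filterlim_at_top)
  then have "\<forall>\<^sub>F n in sequentially. tent a b n x = indicat_real {a<..<b} x"
    by eventually_elim (use c True in \<open>auto simp: tent_def c_def[symmetric] field_simps\<close>)
  then show ?thesis by (rule tendsto_eventually)
qed (simp add: tent_outside)

lemma integrable_tent_mult:
  assumes f: "integrable (segm R) f"
  shows "integrable (segm R) (\<lambda>x. f x * tent a b n x)"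
proof (rule Bochner_Integration.integrable_bound[OF f])
  note [measurable] = borel_measurable_integrable[OF f]
    borel_measurable_segm[OF borel_measurable_continuous_onI[OF continuous_on_tent]]
  show "(\<lambda>x. f x * tent a b n x) \<in> borel_measurable (segm R)" by measurable
  have "\<bar>f x * tent a b n x\<bar> \<le> \<bar>f x\<bar> * 1" for x
    unfolding abs_mult by (intro mult_left_mono) (use tent_bounds[of a b n x] in auto)
  then show "AE x in segm R. norm (f x * tent a b n x) \<le> norm (f x)" by auto
qed

lemma tent_integral_tendsto:
  assumes f: "integrable (segm R) f"
  shows "(\<lambda>n. LINT x|segm R. f x * tent a b n x) \<longlonglongrightarrow> (LINT x|segm R. f x * indicat_real {a<..<b} x)"
proof (rule integral_dominated_convergence[where w="\<lambda>x. \<bar>f x\<bar>"])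
  note [measurable] = borel_measurable_integrable[OF f]
  show "(\<lambda>x. f x * indicat_real {a<..<b} x) \<in> borel_measurable (segm R)" by measurable
  show "(\<lambda>x. f x * tent a b n x) \<in> borel_measurable (segm R)" for n
    using integrable_tent_mult[OF f] by (rule borel_measurable_integrable)
  show "AE x in segm R. (\<lambda>n. f x * tent a b n x) \<longlonglongrightarrow> f x * indicat_real {a<..<b} x"
    by (intro AE_I2 tendsto_mult tendsto_const tent_tendsto)
  have "\<bar>f x * tent a b n x\<bar> \<le> \<bar>f x\<bar> * 1" for n x
    unfolding abs_mult by (intro mult_left_mono) (use tent_bounds[of a b n x] in auto)
  then show "AE x in segm R. norm (f x * tent a b n x) \<le> \<bar>f x\<bar>" for n by auto
qed (use f in simp)

text \<open>A continuous compactly supported function of mean zero is the derivative of a test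
  function. Subtracting a multiple of a fixed weight from a tent produces such a function, so
  \<open>f - c\<close> is orthogonal to all tents, hence in the limit to indicators of
  intervals.\<close>

lemma du_Bois_Reymond:
  assumes f: "integrable (segm R) f" and R: "0 < R"
    and orth: "\<And>\<phi> a b. \<phi> C1_differentiable_on UNIV \<Longrightarrow> 0 < a \<Longrightarrow> b < R \<Longrightarrow>
      (\<And>x. x \<notin> {a..b} \<Longrightarrow> \<phi> x = 0) \<Longrightarrow> (LINT x|segm R. f x * deriv \<phi> x) = 0"
  obtains c where "AE x in segm R. f x = c"
proof -
  have R3: "0 < R / 3" "2 * R / 3 < R" "R / 3 < 2 * R / 3" using R by auto
  let ?I = "\<lambda>h. LINT x|segm R. (h x :: real)"
  have tent1: "integrable (segm R) (tent a b n)" for a b n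
    using integrable_tent_mult[of R "\<lambda>_. 1" a b n] by simp
  have lbI: "(LINT x|lborel. h x) = ?I h" if "\<And>x. x \<notin> {0<..<R} \<Longrightarrow> h x = 0" for h
    unfolding integral_segm using that
    by (intro Bochner_Integration.integral_cong) (auto simp: indicator_def)
  \<comment> \<open>The integrals tend to \<open>R / 3\<close>, so some tent over the middle third
    has positive mass and can serve as the weight.\<close>
  have "(\<lambda>n. ?I (tent (R/3) (2*R/3) n)) \<longlonglongrightarrow> ?I (\<lambda>x. indicat_real {R/3<..<2*R/3} x)"
    using tent_integral_tendsto[of R "\<lambda>_. 1" "R/3" "2*R/3"] by simp
  moreover have "?I (\<lambda>x. indicat_real {R/3<..<2*R/3} x) = R / 3"
  proof -
    have "?I (\<lambda>x. indicat_real {R/3<..<2*R/3} x) = (LINT x|lborel. indicat_real {R/3<..<2*R/3} x)"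
      using R by (intro lbI[symmetric]) (auto simp: indicator_def)
    then show ?thesis using R by simp
  qed
  ultimately have "\<forall>\<^sub>F n in sequentially. 0 < ?I (tent (R/3) (2*R/3) n)"
    using R by (intro order_tendstoD(1)[where y="R / 3"]) (simp_all only: zero_less_divide_iff, simp)
  then obtain m where m: "0 < ?I (tent (R/3) (2*R/3) m)"
    using eventually_happens by fastforce
  define \<eta> where "\<eta> = tent (R/3) (2*R/3) m"
  have \<eta>: "0 < ?I \<eta>" "integrable (segm R) \<eta>" "integrable (segm R) (\<lambda>x. f x * \<eta> x)"
    using m tent1 integrable_tent_mult[OF f] by (simp_all add: \<eta>_def)
  \<comment> \<open>The mean of \<open>f\<close> with respect to the weight \<open>\<eta>\<close>;
    if \<open>f\<close> is constant almost everywhere, this is the constant.\<close>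
  define c where "c = ?I (\<lambda>x. f x * \<eta> x) / ?I \<eta>"
  have tent_eq: "?I (\<lambda>x. f x * tent a b n x) = c * ?I (tent a b n)" if ab: "0 < a" "a < b" "b < R" for a b n
  proof -
    \<comment> \<open>Chosen so that \<open>h\<close> has mean zero.\<close>
    define s where "s = ?I (tent a b n) / ?I \<eta>"
    define h where "h x = tent a b n x - s * \<eta> x" for x
    have supp: "h x = 0" if "x \<notin> {min a (R/3)..max b (2*R/3)}" for x
    proof -
      have "x \<notin> {a<..<b}" "x \<notin> {R/3<..<2*R/3}" using that by auto
      then show ?thesis by (simp add: h_def \<eta>_def tent_outside)
    qed
    have "(LINT x|lborel. h x) = ?I h"
      by (rule lbI, rule supp) (use ab R in auto)
    also have "\<dots> = ?I (tent a b n) - s * ?I \<eta>"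
      unfolding h_def using tent1 \<eta> by simp
    also have "\<dots> = 0" using \<eta>(1) by (simp add: s_def)
    finally have zero: "(LINT x|lborel. h x) = 0" .
    have cont: "continuous_on UNIV h"
      unfolding h_def \<eta>_def by (intro continuous_intros continuous_on_tent)
    obtain \<phi> where \<phi>: "\<phi> C1_differentiable_on UNIV"
      "\<And>x. x \<notin> {min a (R/3)..max b (2*R/3)} \<Longrightarrow> \<phi> x = 0" "deriv \<phi> = h"
      by (rule ex_C1_antiderivative[OF cont supp _ zero]) (use ab in auto)
    have "?I (\<lambda>x. f x * h x) = 0"
      using orth[where a="min a (R/3)" and b="max b (2*R/3)", OF \<phi>(1) _ _ \<phi>(2)] ab R
      by (simp add: \<phi>(3))
    moreover have "(\<lambda>x. f x * h x) = (\<lambda>x. f x * tent a b n x - s * (f x * \<eta> x))"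
      by (simp add: h_def algebra_simps)
    ultimately have "?I (\<lambda>x. f x * tent a b n x) = s * ?I (\<lambda>x. f x * \<eta> x)"
      using integrable_tent_mult[OF f] \<eta> by simp
    then show ?thesis by (simp add: s_def c_def)
  qed
  have fc: "integrable (segm R) (\<lambda>x. f x - c)" using f by simp
  have open_eq: "?I (\<lambda>x. (f x - c) * indicat_real {a<..<b} x) = 0" if ab: "0 < a" "a < b" "b < R" for a b
  proof -
    have "?I (\<lambda>x. (f x - c) * tent a b n x) = 0" for n
      using tent_eq[OF ab] integrable_tent_mult[OF f] tent1 by (simp add: left_diff_distrib)
    then show ?thesis using tent_integral_tendsto[OF fc, of a b] by (simp add: LIMSEQ_const_iff)
  qed
  have "AE x in segm R. f x - c = 0"
  proof (rule AE_segm_zero[OF fc])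
    fix b assume b: "0 < b" "b < R"
    \<comment> \<open>Two successors: the left end point has to be strictly less than
      \<open>b\<close> already for \<open>n = 0\<close>.\<close>
    let ?a = "\<lambda>n. b / real (Suc (Suc n))"
    have lim: "?a \<longlonglongrightarrow> 0"
      using LIMSEQ_Suc[OF LIMSEQ_Suc[OF lim_const_over_n[of b]]] by simp
    note [measurable] = borel_measurable_integrable[OF f]
    have "(\<lambda>n. ?I (\<lambda>x. (f x - c) * indicat_real {?a n<..<b} x)) \<longlonglongrightarrow> ?I (\<lambda>x. indicat_real {..<b} x * (f x - c))"
    proof (rule integral_dominated_convergence[where w="\<lambda>x. \<bar>f x - c\<bar>"])
      show "AE x in segm R. (\<lambda>n. (f x - c) * indicat_real {?a n<..<b} x) \<longlonglongrightarrow> indicat_real {..<b} x * (f x - c)"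
      proof (rule AE_I2)
        fix x assume "x \<in> space (segm R)"
        then have "0 < x" by simp
        from order_tendstoD(2)[OF lim this]
        have "\<forall>\<^sub>F n in sequentially. (f x - c) * indicat_real {?a n<..<b} x = indicat_real {..<b} x * (f x - c)"
          by eventually_elim (auto simp: indicator_def)
        then show "(\<lambda>n. (f x - c) * indicat_real {?a n<..<b} x) \<longlonglongrightarrow> indicat_real {..<b} x * (f x - c)"
          by (rule tendsto_eventually)
      qed
    qed (use fc in \<open>auto simp: indicator_def\<close>)
    moreover have "?I (\<lambda>x. (f x - c) * indicat_real {?a n<..<b} x) = 0" for n
      by (rule open_eq) (use b in \<open>auto simp: field_simps intro: add_pos_nonneg\<close>)
    ultimately show "?I (\<lambda>x. indicat_real {..<b} x * (f x - c)) = 0"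
      by (simp add: LIMSEQ_const_iff)
  qed
  then have "AE x in segm R. f x = c" by eventually_elim simp
  then show ?thesis by (rule that)
qed

section \<open>Integration by parts, and the description of H1 and V0 by primitives\<close>

lemma C1_test_deriv:
  fixes \<phi> :: "real \<Rightarrow> real"
  assumes "\<phi> C1_differentiable_on UNIV" and supp: "\<And>x. x \<notin> {a..b} \<Longrightarrow> \<phi> x = 0"
  shows "(\<phi> has_vector_derivative deriv \<phi> x) (at x)" and "continuous_on UNIV (deriv \<phi>)"
    and "continuous_on UNIV \<phi>" and "\<exists>B. \<forall>x. \<bar>deriv \<phi> x\<bar> \<le> B"
proof -
  from assms(1) obtain D where D: "\<And>x. (\<phi> has_vector_derivative D x) (at x)" "continuous_on UNIV D"
    unfolding C1_differentiable_on_def by auto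
  have eq: "deriv \<phi> = D"
    using D(1) by (auto intro!: DERIV_imp_deriv simp: has_real_derivative_iff_has_vector_derivative)
  show "(\<phi> has_vector_derivative deriv \<phi> x) (at x)" and c: "continuous_on UNIV (deriv \<phi>)"
    using D eq by auto
  show "continuous_on UNIV \<phi>"
    using D(1) by (meson continuous_at_imp_continuous_on has_vector_derivative_continuous)
  have "compact (deriv \<phi> ` {a..b})"
    by (intro compact_continuous_image continuous_on_subset[OF c]) auto
  then obtain B where B: "\<And>x. x \<in> {a..b} \<Longrightarrow> \<bar>deriv \<phi> x\<bar> \<le> B"
    by (force dest: compact_imp_bounded simp: bounded_iff)
  have "deriv \<phi> x = 0" if "x \<notin> {a..b}" for x
  proof -
    have "open (- {a..b})" by (simp add: open_Compl)
    then have "\<forall>\<^sub>F y in nhds x. \<phi> y = 0"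
      unfolding eventually_nhds using that supp by (intro exI[of _ "- {a..b}"]) auto
    then have "deriv \<phi> x = deriv (\<lambda>_. 0) x" by (rule deriv_cong_ev) simp
    then show ?thesis by simp
  qed
  then have "\<bar>deriv \<phi> x\<bar> \<le> max B 0" for x
    using B[of x] by (cases "x \<in> {a..b}") auto
  then show "\<exists>B. \<forall>x. \<bar>deriv \<phi> x\<bar> \<le> B" by blast
qed

text \<open>Since \<open>g\<close> is merely integrable, the product rule is replaced by Fubini's
  theorem on the triangle \<open>y < x\<close>: the inner integral of \<open>deriv \<phi>\<close>
  over \<open>(y, R)\<close> is \<open>- \<phi> y\<close>.\<close>

lemma prim_by_parts:
  assumes g: "integrable (segm R) g" and R: "0 < R" and ab: "0 < a" "b < R"
    and \<phi>: "\<phi> C1_differentiable_on UNIV" "\<And>x. x \<notin> {a..b} \<Longrightarrow> \<phi> x = 0"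
  shows "(LINT x|segm R. (c + prim R g x) * deriv \<phi> x) = - (LINT x|segm R. g x * \<phi> x)"
proof -
  have d: "\<And>x. (\<phi> has_vector_derivative deriv \<phi> x) (at x)" "continuous_on UNIV (deriv \<phi>)"
    "continuous_on UNIV \<phi>" "\<exists>B. \<forall>x. \<bar>deriv \<phi> x\<bar> \<le> B"
    using C1_test_deriv[OF \<phi>] by blast+
  obtain B where B: "\<And>x. \<bar>deriv \<phi> x\<bar> \<le> B" using d(4) by blast
  let ?F = "\<lambda>(x, y). deriv \<phi> x * (indicat_real {..<x} y * g y)"
  \<comment> \<open>The fundamental theorem of calculus on \<open>[y, R]\<close>; the support of
    \<open>\<phi>\<close> ends before \<open>R\<close>, so the upper end contributes
    nothing.\<close>
  have tail: "(LINT x|segm R. indicat_real {y<..} x * deriv \<phi> x) = - \<phi> y" if y: "0 \<le> y" "y \<le> R" for y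
  proof -
    have "(LINT x|segm R. indicat_real {y<..} x * deriv \<phi> x) =
        (LINT x|lborel. indicat_real {y..R} x *\<^sub>R deriv \<phi> x)"
      unfolding integral_segm
    proof (rule integral_cong_AE)
      note [measurable del] = measurable_segm_id
      have [measurable]: "deriv \<phi> \<in> borel_measurable borel"
        by (rule borel_measurable_continuous_onI[OF d(2)])
      show "(\<lambda>x. indicat_real {0<..<R} x * (indicat_real {y<..} x * deriv \<phi> x)) \<in> borel_measurable lborel"
        "(\<lambda>x. indicat_real {y..R} x *\<^sub>R deriv \<phi> x) \<in> borel_measurable lborel"
        by measurable
      show "AE x in lborel. indicat_real {0<..<R} x * (indicat_real {y<..} x * deriv \<phi> x) = indicat_real {y..R} x *\<^sub>R deriv \<phi> x"
        using AE_lborel_singleton[of y] AE_lborel_singleton[of R]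
        by eventually_elim (use y in \<open>auto simp: indicator_def\<close>)
    qed
    also have "\<dots> = \<phi> R - \<phi> y"
      by (rule integral_FTC_atLeastAtMost)
        (use y d in \<open>auto intro: has_vector_derivative_at_within continuous_on_subset\<close>)
    also have "\<phi> R = 0" using ab by (intro \<phi>) auto
    finally show ?thesis by simp
  qed
  note [measurable] = borel_measurable_integrable[OF g] borel_measurable_prim[OF g]
    borel_measurable_segm[OF borel_measurable_continuous_onI[OF d(2)]]
    borel_measurable_segm[OF borel_measurable_continuous_onI[OF d(3)]]
  have bnd: "integrable (segm R) (deriv \<phi>)"
    by (rule segm.integrable_const_bound[of _ B]) (use B in auto)
  have gB: "integrable (segm R \<Otimes>\<^sub>M segm R) (\<lambda>z. B * g (snd z))"
  proof -
    have "integrable (segm R \<Otimes>\<^sub>M segm R) (\<lambda>(x, y). B * g y)"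
      by (rule segm2.Fubini_integrable) (use g in auto)
    then show ?thesis by (simp add: case_prod_beta')
  qed
  have int: "integrable (segm R \<Otimes>\<^sub>M segm R) ?F"
  proof (rule Bochner_Integration.integrable_bound[OF gB])
    have "(\<lambda>z. deriv \<phi> (fst z) * ((if snd z < fst z then 1 else 0) * g (snd z))) \<in> borel_measurable (segm R \<Otimes>\<^sub>M segm R)"
      by measurable
    then show "?F \<in> borel_measurable (segm R \<Otimes>\<^sub>M segm R)"
      by (simp add: indicator_def case_prod_beta' of_bool_def)
    have "\<bar>deriv \<phi> x\<bar> * \<bar>indicat_real {..<x} y * g y\<bar> \<le> \<bar>B\<bar> * \<bar>g y\<bar>" for x y
      using B[of x] by (intro mult_mono) (auto simp: indicator_def)
    then show "AE z in segm R \<Otimes>\<^sub>M segm R. norm (?F z) \<le> norm (B * g (snd z))"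
      by (auto simp: abs_mult)
  qed
  have "(LINT x|segm R. prim R g x * deriv \<phi> x) = (LINT x|segm R. LINT y|segm R. ?F (x, y))"
    by (simp add: prim_def mult.commute)
  also have "\<dots> = (LINT y|segm R. LINT x|segm R. ?F (x, y))"
    using segm2.Fubini_integral[OF int] by simp
  also have "\<dots> = (LINT y|segm R. g y * (LINT x|segm R. indicat_real {y<..} x * deriv \<phi> x))"
  proof (intro Bochner_Integration.integral_cong refl)
    fix y
    have "(LINT x|segm R. ?F (x, y)) = (LINT x|segm R. g y * (indicat_real {y<..} x * deriv \<phi> x))"
      by (intro Bochner_Integration.integral_cong) (auto simp: indicator_def)
    then show "(LINT x|segm R. ?F (x, y)) = g y * (LINT x|segm R. indicat_real {y<..} x * deriv \<phi> x)"
      by simp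
  qed
  also have "\<dots> = (LINT y|segm R. - (g y * \<phi> y))"
    by (intro Bochner_Integration.integral_cong) (auto simp: tail)
  finally have p: "(LINT x|segm R. prim R g x * deriv \<phi> x) = - (LINT x|segm R. g x * \<phi> x)" by simp
  \<comment> \<open>The case \<open>y = 0\<close> of \<open>tail\<close>: a constant is orthogonal
    to derivatives of test functions.\<close>
  have cz: "(LINT x|segm R. c * deriv \<phi> x) = 0"
  proof -
    have "(LINT x|segm R. indicat_real {0<..} x * deriv \<phi> x) = - \<phi> 0"
      using tail[of 0] R by simp
    moreover have "(LINT x|segm R. indicat_real {0<..} x * deriv \<phi> x) = (LINT x|segm R. deriv \<phi> x)"
      by (intro Bochner_Integration.integral_cong) auto
    moreover have "\<phi> 0 = 0" using ab by (intro \<phi>) auto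
    ultimately show ?thesis by simp
  qed
  have i1: "integrable (segm R) (\<lambda>x. c * deriv \<phi> x)" using bnd by simp
  have i2: "integrable (segm R) (\<lambda>x. prim R g x * deriv \<phi> x)"
    using segm2.integrable_fst'[OF int] by (simp add: prim_def mult.commute)
  show ?thesis using p cz i1 i2 by (simp add: distrib_right)
qed

lemma H1_deriv_prim:
  assumes g: "g \<in> L2_space (segm R)" and R: "0 < R"
  shows "H1_deriv R (\<lambda>x. c + prim R g x) g"
  unfolding H1_deriv_def
proof (intro conjI allI impI)
  show "(\<lambda>x. c + prim R g x) \<in> L2_space (segm R)"
    using R by (intro L2_space_add segm.L2_space_const prim_L2_space g) auto
qed (use g prim_by_parts[OF segm.L2_space_integrable[OF g] R] in auto)

text \<open>The difference of \<open>v\<close> and the primitive of \<open>g\<close> has weak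
  derivative zero and is therefore constant. Together with \<open>H1_deriv_prim\<close> this
  identifies H1 functions with constants plus primitives.\<close>

lemma H1_deriv_imp_prim:
  assumes v: "H1_deriv R v g" and R: "0 < R"
  obtains c where "AE x in segm R. v x = c + prim R g x"
proof -
  have L2: "v \<in> L2_space (segm R)" "g \<in> L2_space (segm R)"
    using v by (auto simp: H1_deriv_def)
  have pL2: "prim R g \<in> L2_space (segm R)" using R by (intro prim_L2_space L2) auto
  note int = segm.L2_space_integrable[OF L2(1)] segm.L2_space_integrable[OF pL2]
  obtain c where "AE x in segm R. v x - prim R g x = c"
  proof (rule du_Bois_Reymond[OF _ R])
    show "integrable (segm R) (\<lambda>x. v x - prim R g x)" using int by simp
    fix \<phi> :: "real \<Rightarrow> real" and a b
    assume \<phi>: "\<phi> C1_differentiable_on UNIV" and ab: "0 < a" "b < R" and supp: "\<And>x. x \<notin> {a..b} \<Longrightarrow> \<phi> x = 0"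
    obtain B where B: "\<And>x. \<bar>deriv \<phi> x\<bar> \<le> B" using C1_test_deriv(4)[OF \<phi> supp] by blast
    have [measurable]: "deriv \<phi> \<in> borel_measurable (segm R)"
      by (rule borel_measurable_segm[OF borel_measurable_continuous_onI[OF C1_test_deriv(2)[OF \<phi> supp]]])
    have d: "deriv \<phi> \<in> L2_space (segm R)"
      using L2_space_bounded_mult[OF _ B segm.L2_space_const[where c=1 and R=R]] by simp
    have "(LINT x|segm R. v x * deriv \<phi> x) = - (LINT x|segm R. g x * \<phi> x)"
      using v \<phi> ab supp unfolding H1_deriv_def by blast
    moreover have "(LINT x|segm R. prim R g x * deriv \<phi> x) = - (LINT x|segm R. g x * \<phi> x)"
      using prim_by_parts[OF segm.L2_space_integrable[OF L2(2)] R ab \<phi> supp, of 0] by simp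
    ultimately show "(LINT x|segm R. (v x - prim R g x) * deriv \<phi> x) = 0"
      using L2_space_mult_integrable[OF L2(1) d] L2_space_mult_integrable[OF pL2 d]
      by (simp add: left_diff_distrib)
  qed
  then have "AE x in segm R. v x = c + prim R g x" by eventually_elim (simp add: algebra_simps)
  then show ?thesis by (rule that)
qed

lemma H1_deriv_cong:
  assumes v: "H1_deriv R v g" and w: "w \<in> borel_measurable (segm R)" and eq: "AE x in segm R. v x = w x"
  shows "H1_deriv R w g"
proof -
  have vL2: "v \<in> L2_space (segm R)" using v by (auto simp: H1_deriv_def)
  have "AE x in segm R. (w x)\<^sup>2 \<le> (v x)\<^sup>2" using eq by eventually_elim simp
  then have wL2: "w \<in> L2_space (segm R)" by (rule L2_spaceI[OF w L2_spaceD(2)[OF vL2]])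
  have "(LINT x|segm R. w x * deriv \<phi> x) = (LINT x|segm R. v x * deriv \<phi> x)"
    if \<phi>: "\<phi> C1_differentiable_on UNIV" "\<And>x. x \<notin> {a..b} \<Longrightarrow> \<phi> x = 0" for \<phi> :: "real \<Rightarrow> real" and a b
  proof (rule integral_cong_AE)
    have [measurable]: "deriv \<phi> \<in> borel_measurable (segm R)"
      by (rule borel_measurable_segm[OF borel_measurable_continuous_onI[OF C1_test_deriv(2)[OF \<phi>]]])
    note [measurable] = w L2_spaceD(1)[OF vL2]
    show "(\<lambda>x. w x * deriv \<phi> x) \<in> borel_measurable (segm R)"
      "(\<lambda>x. v x * deriv \<phi> x) \<in> borel_measurable (segm R)" by measurable
    show "AE x in segm R. w x * deriv \<phi> x = v x * deriv \<phi> x" using eq by eventually_elim simp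
  qed
  note eqI = this
  show ?thesis
    unfolding H1_deriv_def
  proof (intro conjI allI impI)
    fix \<phi> :: "real \<Rightarrow> real"
    assume \<phi>: "\<phi> C1_differentiable_on UNIV \<and> (\<exists>a b. 0 < a \<and> b < R \<and> (\<forall>x. x \<notin> {a..b} \<longrightarrow> \<phi> x = 0))"
    then obtain a b where "\<And>x. x \<notin> {a..b} \<Longrightarrow> \<phi> x = 0" by blast
    with \<phi> eqI[of \<phi> a b] have "(LINT x|segm R. w x * deriv \<phi> x) = (LINT x|segm R. v x * deriv \<phi> x)"
      by blast
    also have "\<dots> = - (LINT x|segm R. g x * \<phi> x)"
      using v \<phi> by (simp add: H1_deriv_def)
    finally show "(LINT x|segm R. w x * deriv \<phi> x) = - (LINT x|segm R. g x * \<phi> x)" .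
  qed (use v wL2 in \<open>auto simp: H1_deriv_def\<close>)
qed

text \<open>The value zero at the left end fixes the constant of integration. From here on neither
  test functions in \<open>x\<close> nor continuous representatives are needed to handle V0.\<close>

lemma V0_deriv_iff:
  assumes R: "0 < R"
  shows "V0_deriv R v g \<longleftrightarrow>
    v \<in> borel_measurable (segm R) \<and> g \<in> L2_space (segm R) \<and> (AE x in segm R. v x = prim R g x)"
    (is "_ \<longleftrightarrow> ?r")
proof
  assume v: "V0_deriv R v g"
  then have h: "H1_deriv R v g" by (simp add: V0_deriv_def)
  then have vg: "v \<in> L2_space (segm R)" "g \<in> L2_space (segm R)" by (auto simp: H1_deriv_def)
  from v obtain w where w: "continuous_on {0..R} w" "AE x in segm R. v x = w x" "w 0 = 0"
    unfolding V0_deriv_def boundary_value_def by auto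
  obtain c where c: "AE x in segm R. v x = c + prim R g x"
    by (rule H1_deriv_imp_prim[OF h R])
  \<comment> \<open>Both sides are continuous and agree almost everywhere, so they agree at the end
    point as well.\<close>
  have "w 0 = c + prim R g 0"
  proof (rule AE_eq_imp_eq[where z="\<lambda>x. c + prim R g x"])
    show "AE x in segm R. w x = c + prim R g x"
      using w(2) c by eventually_elim simp
  qed (use w(1) R in \<open>auto intro!: continuous_intros continuous_on_prim segm.L2_space_integrable vg\<close>)
  then have "c = 0" using w(3) by (simp add: prim_0)
  with c vg show ?r by (auto simp: L2_spaceD)
next
  assume r: ?r
  then have "AE x in segm R. 0 + prim R g x = v x" by auto
  with r have "H1_deriv R v g" by (intro H1_deriv_cong[OF H1_deriv_prim[OF _ R, of g 0]]) auto
  moreover have "boundary_value R v 0 0"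
    unfolding boundary_value_def using r
    by (intro exI[of _ "prim R g"]) (auto intro!: continuous_on_prim segm.L2_space_integrable simp: prim_0)
  ultimately show "V0_deriv R v g" by (simp add: V0_deriv_def)
qed

text \<open>Expresses the trace at \<open>R\<close> as an integral, which makes the trace of a
  time-dependent function measurable in time without selecting representatives.\<close>

lemma V0_boundary_value:
  assumes v: "V0_deriv R v g" and R: "0 < R"
  shows "boundary_value R v R (LINT x|segm R. g x)"
  using v unfolding V0_deriv_iff[OF R] boundary_value_def
  by (intro exI[of _ "prim R g"]) (auto intro!: continuous_on_prim segm.L2_space_integrable simp: prim_right)

section \<open>Functions on the space-time cylinder\<close>

lemma integrable_cyl_swap:
  fixes F :: "real \<times> real \<Rightarrow> real"
  assumes "integrable (cyl T L) F"
  shows "integrable (cyl L T) (\<lambda>z. F (snd z, fst z))"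
  using segm2.integrable_product_swap[OF assms[unfolded cyl_def]] by (simp add: cyl_def case_prod_beta')

lemma integral_cyl_swap:
  assumes "F \<in> borel_measurable (cyl T L)"
  shows "integral\<^sup>L (cyl L T) (\<lambda>z. F (snd z, fst z)) = integral\<^sup>L (cyl T L) (F :: _ \<Rightarrow> real)"
  using segm2.integral_product_swap[OF assms[unfolded cyl_def]] by (simp add: cyl_def case_prod_beta')

lemma borel_measurable_cyl_swap:
  assumes "F \<in> borel_measurable (cyl T L)"
  shows "(\<lambda>z. F (snd z, fst z)) \<in> borel_measurable (cyl L T)"
  using assms unfolding cyl_def by measurable

lemma L2_space_cyl_swap:
  assumes F: "F \<in> L2_space (cyl T L)"
  shows "(\<lambda>z. F (snd z, fst z)) \<in> L2_space (cyl L T)"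
  using borel_measurable_cyl_swap[OF L2_spaceD(1)[OF F]] integrable_cyl_swap[OF L2_spaceD(2)[OF F]]
  by (simp add: L2_space_def)

lemma integral_cyl:
  assumes "integrable (cyl T L) F"
  shows "(LINT t|segm T. LINT x|segm L. F (t, x)) = integral\<^sup>L (cyl T L) (F :: _ \<Rightarrow> real)"
    and "integrable (segm T) (\<lambda>t. LINT x|segm L. F (t, x))"
    and "AE t in segm T. integrable (segm L) (\<lambda>x. F (t, x))"
  using segm2.integral_fst'[OF assms[unfolded cyl_def]] segm2.integrable_fst'[OF assms[unfolded cyl_def]]
    segm2.AE_integrable_fst'[OF assms[unfolded cyl_def]]
  by (simp_all add: cyl_def)

lemma space_cyl: "space (cyl T L) = {0<..<T} \<times> {0<..<L}"
  by (simp add: cyl_def space_pair_measure)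

lemma AE_cyl_iff:
  assumes "f \<in> borel_measurable (cyl T L)" "g \<in> borel_measurable (cyl T L)"
  shows "(AE z in cyl T L. f z = (g z :: real)) \<longleftrightarrow> (AE t in segm T. AE x in segm L. f (t, x) = g (t, x))"
proof -
  note [measurable] = assms[unfolded cyl_def]
  have "{z \<in> space (segm T \<Otimes>\<^sub>M segm L). f z = g z} \<in> sets (segm T \<Otimes>\<^sub>M segm L)"
    by measurable
  then have "{z \<in> space (segm T \<Otimes>\<^sub>M segm L). f (fst z, snd z) = g (fst z, snd z)} \<in> sets (segm T \<Otimes>\<^sub>M segm L)"
    by simp
  from segm2.AE_pair_iff[of _ _ "\<lambda>t x. f (t, x) = g (t, x)", OF this] show ?thesis
    unfolding cyl_def by simp
qed

lemma AE_cyl_fstI: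
  assumes "AE t in segm T. P t"
  shows "AE z in cyl T L. P (fst z)"
proof -
  obtain N where N: "{t \<in> space (segm T). \<not> P t} \<subseteq> N" "emeasure (segm T) N = 0" "N \<in> sets (segm T)"
    using AE_E[OF assms] by blast
  show ?thesis
  proof (rule AE_I)
    show "{z \<in> space (cyl T L). \<not> P (fst z)} \<subseteq> N \<times> space (segm L)"
      using N(1) by (auto simp: space_cyl)
    show "emeasure (cyl T L) (N \<times> space (segm L)) = 0"
      unfolding cyl_def using N by (subst segm.emeasure_pair_measure_Times) (auto simp del: space_segm)
    show "N \<times> space (segm L) \<in> sets (cyl T L)"
      unfolding cyl_def using N(3) by (intro pair_measureI sets.top)
  qed
qed

lemma L2_cyl_sections:
  assumes F: "F \<in> L2_space (cyl T L)"
  shows "AE t in segm T. (\<lambda>x. F (t, x)) \<in> L2_space (segm L)"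
proof -
  have m: "(\<lambda>x. F (t, x)) \<in> borel_measurable (segm L)" if "t \<in> {0<..<T}" for t
    using L2_spaceD(1)[OF F] that unfolding cyl_def by simp
  show ?thesis
    using integral_cyl(3)[OF L2_spaceD(2)[OF F]] AE_space
    by eventually_elim (use m in \<open>auto simp: L2_space_def\<close>)
qed

lemma L2_cyl_sections_snd:
  assumes F: "F \<in> L2_space (cyl T L)"
  shows "AE x in segm L. (\<lambda>t. F (t, x)) \<in> L2_space (segm T)"
  using L2_cyl_sections[OF L2_space_cyl_swap[OF F]] by simp

lemma integrable_cyl_fst:
  assumes "integrable (segm T) f"
  shows "integrable (cyl T L) (\<lambda>z. f (fst z) :: real)"
proof -
  note [measurable] = borel_measurable_integrable[OF assms]
  have "integrable (segm T \<Otimes>\<^sub>M segm L) (\<lambda>(t, x). f t)"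
    by (rule segm2.Fubini_integrable) (use assms in auto)
  then show ?thesis by (simp add: cyl_def case_prod_beta')
qed

section \<open>Primitives in space, the Poincare inequality and V0-valued functions\<close>

text \<open>For joint measurability: the set in the indicator depends on a variable, whereas the
  conditional is a comparison of two measurable coordinates.\<close>

lemma indicator_lessThan_if: "indicat_real {..<x} y = (if y < x then 1 else 0)"
  by (simp add: indicator_def)

lemma indicator_greaterThanLessThan_if:
  "indicat_real {x<..<z} y = (if x < y then 1 else 0) * (if y < z then 1 else (0::real))"
  by (simp add: indicator_def)

definition cprim :: "real \<Rightarrow> (real \<times> real \<Rightarrow> real) \<Rightarrow> real \<times> real \<Rightarrow> real" where
  "cprim L F z = prim L (\<lambda>y. F (fst z, y)) (snd z)"

lemma borel_measurable_cprim:
  assumes [measurable]: "F \<in> borel_measurable (cyl T L)"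
  shows "cprim L F \<in> borel_measurable (cyl T L)"
proof -
  note [measurable] = assms[unfolded cyl_def]
  show ?thesis
    unfolding cprim_def[abs_def] prim_def indicator_lessThan_if cyl_def by measurable
qed

lemma cprim_power2_le:
  assumes F: "F \<in> L2_space (cyl T L)" and L: "0 < L"
  shows "AE z in cyl T L. (cprim L F z)\<^sup>2 \<le> L * (LINT y|segm L. (F (fst z, y))\<^sup>2)"
  using AE_cyl_fstI[OF L2_cyl_sections[OF F]]
  by eventually_elim (use prim_power2_le L in \<open>auto simp: cprim_def\<close>)

text \<open>The Poincare inequality with constant \<open>L\<close>, applied at almost every time and
  integrated.\<close>

lemma cprim_L2_space:
  assumes F: "F \<in> L2_space (cyl T L)" and L: "0 < L"
  shows "cprim L F \<in> L2_space (cyl T L)"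
    and "(LINT z|cyl T L. (cprim L F z)\<^sup>2) \<le> L\<^sup>2 * (LINT z|cyl T L. (F z)\<^sup>2)"
proof -
  have int: "integrable (segm T) (\<lambda>t. L * (LINT y|segm L. (F (t, y))\<^sup>2))"
    using integral_cyl(2)[OF L2_spaceD(2)[OF F]] by simp
  note int2 = integrable_cyl_fst[OF int, where L=L]
  show L2: "cprim L F \<in> L2_space (cyl T L)"
    by (rule L2_spaceI[OF borel_measurable_cprim[OF L2_spaceD(1)[OF F]] int2 cprim_power2_le[OF F L]])
  have "(LINT z|cyl T L. (cprim L F z)\<^sup>2) \<le> (LINT z|cyl T L. L * (LINT y|segm L. (F (fst z, y))\<^sup>2))"
    by (rule integral_mono_AE[OF L2_spaceD(2)[OF L2] int2 cprim_power2_le[OF F L]])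
  \<comment> \<open>The first factor comes from the pointwise bound, the second from integrating
    over \<open>x\<close> a function of time only.\<close>
  also have "\<dots> = L * L * (LINT t|segm T. LINT y|segm L. (F (t, y))\<^sup>2)"
    using integral_cyl(1)[OF int2] L by (simp add: mult.assoc)
  also have "\<dots> = L\<^sup>2 * (LINT z|cyl T L. (F z)\<^sup>2)"
    using integral_cyl(1)[OF L2_spaceD(2)[OF F]] by (simp add: power2_eq_square)
  finally show "(LINT z|cyl T L. (cprim L F z)\<^sup>2) \<le> L\<^sup>2 * (LINT z|cyl T L. (F z)\<^sup>2)" .
qed

text \<open>Joint measurability of \<open>cprim\<close> merges the conditions on the individual time
  sections into one equation almost everywhere on the cylinder.\<close>

lemma L2_V0_iff:
  assumes L: "0 < L"
  shows "L2_V0 T L u ux \<longleftrightarrow>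
    u \<in> L2_space (cyl T L) \<and> ux \<in> L2_space (cyl T L) \<and> (AE z in cyl T L. u z = cprim L ux z)"
proof -
  have "(AE t in segm T. V0_deriv L (\<lambda>x. u (t, x)) (\<lambda>x. ux (t, x))) \<longleftrightarrow>
      (AE z in cyl T L. u z = cprim L ux z)"
    if u: "u \<in> L2_space (cyl T L)" and ux: "ux \<in> L2_space (cyl T L)"
  proof -
    have "(AE t in segm T. V0_deriv L (\<lambda>x. u (t, x)) (\<lambda>x. ux (t, x))) \<longleftrightarrow>
        (AE t in segm T. AE x in segm L. u (t, x) = cprim L ux (t, x))"
    proof (rule eventually_cong)
      show "AE t in segm T. (\<lambda>x. u (t, x)) \<in> L2_space (segm L) \<and> (\<lambda>x. ux (t, x)) \<in> L2_space (segm L)"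
        using L2_cyl_sections[OF u] L2_cyl_sections[OF ux] by eventually_elim simp
    qed (auto simp: V0_deriv_iff[OF L] cprim_def L2_spaceD)
    also have "\<dots> \<longleftrightarrow> (AE z in cyl T L. u z = cprim L ux z)"
      by (rule AE_cyl_iff[symmetric]) (auto intro: borel_measurable_cprim L2_spaceD u ux)
    finally show ?thesis .
  qed
  then show ?thesis unfolding L2_V0_def by blast
qed

lemma L2_V0_lincomb:
  assumes L: "0 < L" and u: "L2_V0 T L u ux" and v: "L2_V0 T L v vx"
  shows "L2_V0 T L (\<lambda>z. a * u z + b * v z) (\<lambda>z. a * ux z + b * vx z)"
proof -
  have "AE z in cyl T L. cprim L (\<lambda>z. a * ux z + b * vx z) z = a * cprim L ux z + b * cprim L vx z"
  proof -
    have "ux \<in> L2_space (cyl T L)" "vx \<in> L2_space (cyl T L)"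
      using u v by (auto simp: L2_V0_def)
    from AE_cyl_fstI[OF L2_cyl_sections[OF this(1)]] AE_cyl_fstI[OF L2_cyl_sections[OF this(2)]]
    show ?thesis
      by eventually_elim (auto simp: cprim_def intro!: prim_lincomb segm.L2_space_integrable)
  qed
  moreover have "AE z in cyl T L. u z = cprim L ux z" "AE z in cyl T L. v z = cprim L vx z"
    using u v L2_V0_iff[OF L] by auto
  ultimately have "AE z in cyl T L. a * u z + b * v z = cprim L (\<lambda>z. a * ux z + b * vx z) z"
    by eventually_elim simp
  with u v show ?thesis
    unfolding L2_V0_iff[OF L] by (auto intro!: L2_space_add L2_space_cmult)
qed

text \<open>V0 leaves the value at \<open>L\<close> free, so every square-integrable function is the
  derivative of an admissible \<open>v\<close>. Hence the integrand itself vanishes, which encodes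
  the natural boundary condition at \<open>L\<close> too.\<close>

lemma elliptic_pointwise:
  assumes L: "0 < L" and ux: "ux \<in> L2_space (cyl T L)" and p: "p \<in> L2_space (cyl T L)"
    and eq: "\<And>v vx. V0_deriv L v vx \<Longrightarrow>
      AE t in segm T. (LINT x|segm L. (H * ux (t, x) - p (t, x)) * vx x) = 0"
  shows "AE z in cyl T L. H * ux z = p z"
proof -
  have "AE t in segm T. (LINT x|segm L. indicat_real {..<b} x * (H * ux (t, x) - p (t, x))) = 0" for b
  proof -
    have i: "(\<lambda>x. indicat_real {..<b} x) \<in> L2_space (segm L)"
      by (rule L2_spaceI[of _ _ "\<lambda>_. 1"]) (auto simp: indicator_def)
    have "V0_deriv L (prim L (indicat_real {..<b})) (indicat_real {..<b})"
      unfolding V0_deriv_iff[OF L] using i segm.L2_space_integrable[OF i]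
      by (auto intro: borel_measurable_prim)
    from eq[OF this] show ?thesis by (simp add: mult.commute)
  qed
  \<comment> \<open>The exceptional times depend on \<open>b\<close>; restricting \<open>b\<close>
    to a countable set allows the two quantifiers to be exchanged.\<close>
  then have "AE t in segm T. \<forall>b\<in>\<rat>. (LINT x|segm L. indicat_real {..<b} x * (H * ux (t, x) - p (t, x))) = 0"
    by (intro AE_ball_countable[THEN iffD2] countable_rat ballI)
  then have "AE t in segm T. AE x in segm L. H * ux (t, x) = p (t, x)"
    using L2_cyl_sections[OF ux] L2_cyl_sections[OF p]
  proof eventually_elim
    case (elim t)
    have "AE x in segm L. H * ux (t, x) - p (t, x) = 0"
      by (rule AE_segm_zero) (use elim in \<open>auto intro!: segm.L2_space_integrable L2_space_diff L2_space_cmult\<close>)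
    then show ?case by eventually_elim simp
  qed
  then show ?thesis
    using L2_spaceD(1)[OF ux] L2_spaceD(1)[OF p] by (subst AE_cyl_iff) auto
qed

text \<open>The product \<open>h t * h s\<close> is symmetric and the diagonal splits the square
  into two mirror-image triangles. Here this replaces writing the integrand as the time derivative
  of a square.\<close>

lemma integral_triangle:
  assumes h: "integrable (segm T) h"
  shows "(LINT t|segm T. h t * (LINT s|segm T. indicat_real {t<..} s * h s)) = (LINT t|segm T. h t)\<^sup>2 / 2"
proof -
  note [measurable] = borel_measurable_integrable[OF h]
  let ?F = "\<lambda>z. h (fst z) * h (snd z)"
  let ?U = "\<lambda>z. (if fst z < snd z then 1 else 0) * ?F z"
  have F: "integrable (cyl T T) ?F"
  proof -
    have "integrable (segm T \<Otimes>\<^sub>M segm T) (\<lambda>(t, x). h t * h x)"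
      by (rule segm2.Fubini_integrable) (use h in \<open>auto simp: abs_mult\<close>)
    then show ?thesis by (simp add: cyl_def case_prod_beta')
  qed
  have U: "integrable (cyl T T) ?U"
  proof (rule Bochner_Integration.integrable_bound[OF F])
    show "?U \<in> borel_measurable (cyl T T)" unfolding cyl_def by measurable
  qed auto
  have "(LINT t|segm T. h t)\<^sup>2 = (LINT t|segm T. LINT s|segm T. ?F (t, s))"
    by (simp add: power2_eq_square)
  also have "\<dots> = integral\<^sup>L (cyl T T) ?F" by (rule integral_cyl(1)[OF F])
  also have "\<dots> = integral\<^sup>L (cyl T T) (\<lambda>z. ?U z + ?U (snd z, fst z))"
  proof (rule integral_cong_AE)
    show "?F \<in> borel_measurable (cyl T T)" using F by (rule borel_measurable_integrable)
    show "(\<lambda>z. ?U z + ?U (snd z, fst z)) \<in> borel_measurable (cyl T T)"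
      unfolding cyl_def by measurable
    \<comment> \<open>On the diagonal neither triangle counts, so the splitting holds only outside
      this null set.\<close>
    have "AE z in cyl T T. fst z \<noteq> snd z"
      unfolding cyl_def
    proof (rule segm2.AE_pair_measure)
      show "{z \<in> space (segm T \<Otimes>\<^sub>M segm T). fst z \<noteq> snd z} \<in> sets (segm T \<Otimes>\<^sub>M segm T)"
        by measurable
      have "AE y in segm T. fst (x, y) \<noteq> snd (x, y)" for x
        using AE_segm_neq[of x] by eventually_elim auto
      then show "AE x in segm T. AE y in segm T. fst (x, y) \<noteq> snd (x, y)" by simp
    qed
    then show "AE z in cyl T T. ?F z = ?U z + ?U (snd z, fst z)"
      by eventually_elim auto
  qed
  also have "\<dots> = 2 * integral\<^sup>L (cyl T T) ?U"
    using U integrable_cyl_swap[OF U] integral_cyl_swap[OF borel_measurable_integrable[OF U]] by simp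
  also have "integral\<^sup>L (cyl T T) ?U = (LINT t|segm T. h t * (LINT s|segm T. indicat_real {t<..} s * h s))"
    unfolding integral_cyl(1)[OF U, symmetric]
  proof (intro Bochner_Integration.integral_cong refl)
    fix t
    have "(LINT s|segm T. ?U (t, s)) = (LINT s|segm T. h t * (indicat_real {t<..} s * h s))"
      by (intro Bochner_Integration.integral_cong) (auto simp: indicator_def)
    then show "(LINT s|segm T. ?U (t, s)) = h t * (LINT s|segm T. indicat_real {t<..} s * h s)" by simp
  qed
  finally show ?thesis by simp
qed

section \<open>The energy estimate\<close>

lemma AE_cyl_sndI:
  assumes "AE x in segm L. P x"
  shows "AE z in cyl T L. P (snd z)"
proof -
  obtain N where N: "{x \<in> space (segm L). \<not> P x} \<subseteq> N" "emeasure (segm L) N = 0" "N \<in> sets (segm L)"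
    using AE_E[OF assms] by blast
  show ?thesis
  proof (rule AE_I)
    show "{z \<in> space (cyl T L). \<not> P (snd z)} \<subseteq> space (segm T) \<times> N"
      using N(1) by (auto simp: space_cyl)
    show "emeasure (cyl T L) (space (segm T) \<times> N) = 0"
      unfolding cyl_def using N by (subst segm.emeasure_pair_measure_Times) (auto simp del: space_segm)
    show "space (segm T) \<times> N \<in> sets (cyl T L)"
      unfolding cyl_def using N(3) by (intro pair_measureI sets.top)
  qed
qed

lemma integrable_cyl_snd:
  assumes "integrable (segm L) f"
  shows "integrable (cyl T L) (\<lambda>z. f (snd z) :: real)"
  using integrable_cyl_swap[OF integrable_cyl_fst[OF assms, of T]] by simp

lemma integral_cyl_snd:
  assumes F: "integrable (cyl T L) F"
  shows "(LINT x|segm L. LINT t|segm T. F (t, x)) = integral\<^sup>L (cyl T L) (F :: _ \<Rightarrow> real)"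
    and "integrable (segm L) (\<lambda>x. LINT t|segm T. F (t, x))"
    and "AE x in segm L. integrable (segm T) (\<lambda>t. F (t, x))"
  using integral_cyl[OF integrable_cyl_swap[OF F]] integral_cyl_swap[OF borel_measurable_integrable[OF F]]
  by simp_all

text \<open>The \<open>x\<close>-derivative of the test function \<open>q(t, x) = \<integral>\<^sub>t\<^sup>\<tau> p(s, x) ds\<close>, where \<open>g = p\<^sub>x\<close>.\<close>

definition back_int :: "real \<Rightarrow> real \<Rightarrow> (real \<times> real \<Rightarrow> real) \<Rightarrow> real \<times> real \<Rightarrow> real" where
  "back_int T \<tau> g z = (LINT s|segm T. indicat_real {fst z<..<\<tau>} s * g (s, snd z))"

lemma borel_measurable_back_int:
  assumes "g \<in> borel_measurable (cyl T L)"
  shows "back_int T \<tau> g \<in> borel_measurable (cyl T L)"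
proof -
  note [measurable] = assms[unfolded cyl_def]
  show ?thesis
    unfolding back_int_def[abs_def] indicator_greaterThanLessThan_if cyl_def by measurable
qed

lemma indicator_mult_power2_le:
  assumes h: "h \<in> L2_space (segm T)" and [measurable]: "B \<in> sets borel" and T: "0 < T"
  shows "(LINT s|segm T. indicat_real B s * h s)\<^sup>2 \<le> T * (LINT s|segm T. (h s)\<^sup>2)"
proof -
  have i: "(\<lambda>y. indicat_real B y) \<in> borel_measurable (segm T)" by measurable
  have ih: "(\<lambda>s. indicat_real B s * h s) \<in> L2_space (segm T)"
    by (rule L2_space_bounded_mult[OF i _ h, of 1]) (auto simp: indicator_def)
  have "(LINT s|segm T. indicat_real B s * h s)\<^sup>2 \<le> T * (LINT s|segm T. (indicat_real B s * h s)\<^sup>2)"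
    using segm.L2_integral_power2_le[OF ih] T by simp
  also have "\<dots> \<le> T * (LINT s|segm T. (h s)\<^sup>2)"
    using L2_spaceD(2)[OF ih] L2_spaceD(2)[OF h] T
    by (intro mult_left_mono integral_mono) (auto simp: indicator_def)
  finally show ?thesis .
qed

lemma back_int_L2_space:
  assumes g: "g \<in> L2_space (cyl T L)" and T: "0 < T"
  shows "back_int T \<tau> g \<in> L2_space (cyl T L)"
proof (rule L2_spaceI[OF borel_measurable_back_int[OF L2_spaceD(1)[OF g]]])
  have "integrable (segm L) (\<lambda>x. T * (LINT s|segm T. (g (s, x))\<^sup>2))"
    using integral_cyl_snd(2)[OF L2_spaceD(2)[OF g]] by simp
  then show "integrable (cyl T L) (\<lambda>z. T * (LINT s|segm T. (g (s, snd z))\<^sup>2))"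
    by (rule integrable_cyl_snd)
  show "AE z in cyl T L. (back_int T \<tau> g z)\<^sup>2 \<le> T * (LINT s|segm T. (g (s, snd z))\<^sup>2)"
    using AE_cyl_sndI[OF L2_cyl_sections_snd[OF g]]
    by eventually_elim (use indicator_mult_power2_le T in \<open>auto simp: back_int_def\<close>)
qed

text \<open>Fubini interchanges the primitive in \<open>x\<close> with the time integral: the
  function whose \<open>x\<close>-derivative is \<open>back_int\<close> is the backward time
  integral of \<open>cprim L g\<close>.\<close>

lemma cprim_back_int:
  assumes g: "g \<in> L2_space (cyl T L)"
  shows "cprim L (back_int T \<tau> g) (t, x) =
    (LINT s|segm T. indicat_real {t<..<\<tau>} s * cprim L g (s, x))"
proof -
  let ?K = "\<lambda>(s, y). indicat_real {..<x} y * (indicat_real {t<..<\<tau>} s * g (s, y))"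
  note int = cyl.L2_space_integrable[OF g, unfolded cyl_def]
  note [measurable] = borel_measurable_integrable[OF int]
  have K: "integrable (segm T \<Otimes>\<^sub>M segm L) ?K"
  proof (rule Bochner_Integration.integrable_bound[OF int])
    show "?K \<in> borel_measurable (segm T \<Otimes>\<^sub>M segm L)"
      unfolding indicator_lessThan_if indicator_greaterThanLessThan_if by measurable
  qed (auto simp: indicator_def)
  have "cprim L (back_int T \<tau> g) (t, x) = (LINT y|segm L. LINT s|segm T. ?K (s, y))"
    by (simp add: cprim_def prim_def back_int_def)
  also have "\<dots> = (LINT s|segm T. LINT y|segm L. ?K (s, y))"
    using segm2.Fubini_integral[OF K] by simp
  also have "\<dots> = (LINT s|segm T. indicat_real {t<..<\<tau>} s * cprim L g (s, x))"
  proof (intro Bochner_Integration.integral_cong refl)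
    fix s
    have "(LINT y|segm L. ?K (s, y)) =
        (LINT y|segm L. indicat_real {t<..<\<tau>} s * (indicat_real {..<x} y * g (s, y)))"
      by (intro Bochner_Integration.integral_cong) auto
    then show "(LINT y|segm L. ?K (s, y)) = indicat_real {t<..<\<tau>} s * cprim L g (s, x)"
      by (simp add: cprim_def prim_def)
  qed
  finally show ?thesis .
qed

lemma prim_complement:
  assumes h: "integrable (segm T) h"
  shows "(LINT s|segm T. indicat_real {t<..} s * h s) = (LINT s|segm T. h s) - prim T h t"
proof -
  note [measurable] = borel_measurable_integrable[OF h]
  note i = integrable_indicator_mult[OF h measurable_segm_id, of "{..<t}"]
  have "(LINT s|segm T. indicat_real {t<..} s * h s) = (LINT s|segm T. h s - indicat_real {..<t} s * h s)"
  proof (rule integral_cong_AE)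
    show "AE s in segm T. indicat_real {t<..} s * h s = h s - indicat_real {..<t} s * h s"
      using AE_segm_neq[of t] by eventually_elim (auto simp: indicator_def)
  qed (use i h in auto)
  then show ?thesis using i h by (simp add: prim_def)
qed

text \<open>The time derivative of the test function. It is written with \<open>cprim L g\<close>,
  which equals p only almost everywhere, so that it is a primitive in \<open>x\<close> at every
  point.\<close>

definition test_t :: "real \<Rightarrow> real \<Rightarrow> (real \<times> real \<Rightarrow> real) \<Rightarrow> real \<times> real \<Rightarrow> real" where
  "test_t L \<tau> g z = - indicat_real {..<\<tau>} (fst z) * cprim L g z"

lemma L2_space_indicator_fst:
  assumes F: "F \<in> L2_space (cyl T L)"
  shows "(\<lambda>z. c * indicat_real {..<\<tau>} (fst z) * F z) \<in> L2_space (cyl T L)"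
proof (rule L2_space_bounded_mult[OF _ _ F])
  show "(\<lambda>z. c * indicat_real {..<\<tau>} (fst z)) \<in> borel_measurable (cyl T L)"
    unfolding cyl_def by measurable
  show "\<bar>c * indicat_real {..<\<tau>} (fst z)\<bar> \<le> \<bar>c\<bar>" for z :: "real \<times> real"
    by (auto simp: indicator_def)
qed

text \<open>For almost every \<open>x\<close> the test function is a constant plus the primitive in
  time of \<open>test_t\<close>, and that constant is the one for which the value at
  \<open>T\<close> is zero.\<close>

lemma test_function_admissible:
  assumes g: "g \<in> L2_space (cyl T L)" and T: "0 < T" and L: "0 < L"
  shows "H1_V0_final_zero T L (cprim L (back_int T \<tau> g)) (back_int T \<tau> g) (test_t L \<tau> g)"
  unfolding H1_V0_final_zero_def
proof (intro conjI exI)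
  note qx = back_int_L2_space[OF g T, of \<tau>]
  note q = cprim_L2_space(1)[OF qx L]
  show "L2_V0 T L (cprim L (back_int T \<tau> g)) (back_int T \<tau> g)"
    unfolding L2_V0_iff[OF L] using q qx by simp
  have qt: "test_t L \<tau> g \<in> L2_space (cyl T L)"
    using L2_space_indicator_fst[OF cprim_L2_space(1)[OF g L], of "-1" \<tau>] by (simp add: test_t_def[abs_def])
  \<comment> \<open>The truncation in time commutes with the primitive in \<open>x\<close>; this
    supplies the \<open>x\<close>-derivative of the time derivative.\<close>
  have "test_t L \<tau> g z = cprim L (\<lambda>z. - 1 * indicat_real {..<\<tau>} (fst z) * g z) z" for z
    by (simp add: test_t_def cprim_def prim_def mult.left_commute)
  then show "L2_V0 T L (test_t L \<tau> g) (\<lambda>z. - 1 * indicat_real {..<\<tau>} (fst z) * g z)"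
    unfolding L2_V0_iff[OF L] using qt L2_space_indicator_fst[OF g, of "-1" \<tau>] by simp
  show "AE x in segm L. H1_deriv T (\<lambda>t. cprim L (back_int T \<tau> g) (t, x)) (\<lambda>t. test_t L \<tau> g (t, x)) \<and>
      boundary_value T (\<lambda>t. cprim L (back_int T \<tau> g) (t, x)) T 0"
    using L2_cyl_sections_snd[OF qt] L2_cyl_sections_snd[OF q]
  proof eventually_elim
    case (elim x)
    let ?h = "\<lambda>t. test_t L \<tau> g (t, x)"
    have h: "integrable (segm T) ?h" using segm.L2_space_integrable[OF elim(1)] .
    \<comment> \<open>Truncating at \<open>\<tau>\<close> is absorbed into \<open>?h\<close>, which
      vanishes from \<open>\<tau>\<close> on.\<close>
    have eq: "cprim L (back_int T \<tau> g) (t, x) = - (LINT s|segm T. ?h s) + prim T ?h t" for t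
    proof -
      have "(\<lambda>s. indicat_real {t<..<\<tau>} s * cprim L g (s, x)) = (\<lambda>s. - (indicat_real {t<..} s * ?h s))"
        by (auto simp: test_t_def indicator_def)
      then show ?thesis by (simp add: cprim_back_int[OF g] prim_complement[OF h])
    qed
    have "H1_deriv T (\<lambda>t. cprim L (back_int T \<tau> g) (t, x)) ?h"
      unfolding eq by (rule H1_deriv_prim[OF elim(1) T])
    moreover have "boundary_value T (\<lambda>t. cprim L (back_int T \<tau> g) (t, x)) T 0"
      unfolding boundary_value_def
    proof (intro exI conjI)
      show "continuous_on {0..T} (\<lambda>t. - (LINT s|segm T. ?h s) + prim T ?h t)"
        by (intro continuous_intros continuous_on_prim h)
    qed (simp_all add: eq prim_right)
    ultimately show ?case ..
  qed
qed

text \<open>For \<open>g = p\<^sub>x\<close> this is \<open>\<integral>\<^sub>0\<^sup>\<tau> p(L, s) ds\<close>, because \<open>p(0, s) = 0\<close>.\<close>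

definition trace_int :: "real \<Rightarrow> real \<Rightarrow> (real \<times> real \<Rightarrow> real) \<Rightarrow> real \<Rightarrow> real" where
  "trace_int T L g \<tau> = (LINT x|segm L. LINT s|segm T. indicat_real {..<\<tau>} s * g (s, x))"

lemma integrable_indicator_cyl:
  assumes g: "g \<in> L2_space (cyl T L)"
  shows "integrable (cyl T L) (\<lambda>z. indicat_real {..<\<tau>} (fst z) * g z)"
  using cyl.L2_space_integrable[OF L2_space_indicator_fst[OF g, of 1]] by simp

text \<open>A crude bound uniform in \<open>\<tau>\<close>, whose purpose is to make the supremum of
  the traces finite.\<close>

lemma abs_trace_int_le:
  assumes g: "g \<in> L2_space (cyl T L)"
  shows "\<bar>trace_int T L g \<tau>\<bar> \<le> (LINT z|cyl T L. \<bar>g z\<bar>)"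
proof -
  note int = integrable_indicator_cyl[OF g, of \<tau>]
  have "trace_int T L g \<tau> = (LINT z|cyl T L. indicat_real {..<\<tau>} (fst z) * g z)"
    unfolding trace_int_def using integral_cyl_snd(1)[OF int] by simp
  also have "\<bar>\<dots>\<bar> \<le> (LINT z|cyl T L. \<bar>indicat_real {..<\<tau>} (fst z) * g z\<bar>)"
    by (rule integral_abs_bound)
  also have "\<dots> \<le> (LINT z|cyl T L. \<bar>g z\<bar>)"
    using int cyl.L2_space_integrable[OF g] by (intro integral_mono) (auto simp: indicator_def)
  finally show ?thesis .
qed

text \<open>Cauchy-Schwarz in \<open>x\<close>. The right side is, up to constants, the diffusion
  term of the energy identity, so the energy controls the trace.\<close>

lemma trace_int_power2_le:
  assumes g: "g \<in> L2_space (cyl T L)" and T: "0 < T" and L: "0 < L"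
  shows "(trace_int T L g \<tau>)\<^sup>2 \<le> L * (LINT x|segm L. (LINT s|segm T. indicat_real {..<\<tau>} s * g (s, x))\<^sup>2)"
    and "integrable (segm L) (\<lambda>x. (LINT s|segm T. indicat_real {..<\<tau>} s * g (s, x))\<^sup>2)"
proof -
  have m: "(\<lambda>x. LINT s|segm T. indicat_real {..<\<tau>} s * g (s, x)) \<in> borel_measurable (segm L)"
    using borel_measurable_integrable[OF integral_cyl_snd(2)[OF integrable_indicator_cyl[OF g]]] by simp
  have L2: "(\<lambda>x. LINT s|segm T. indicat_real {..<\<tau>} s * g (s, x)) \<in> L2_space (segm L)"
  proof (rule L2_spaceI[OF m])
    show "integrable (segm L) (\<lambda>x. T * (LINT s|segm T. (g (s, x))\<^sup>2))"
      using integral_cyl_snd(2)[OF L2_spaceD(2)[OF g]] by simp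
    show "AE x in segm L. (LINT s|segm T. indicat_real {..<\<tau>} s * g (s, x))\<^sup>2 \<le> T * (LINT s|segm T. (g (s, x))\<^sup>2)"
      using L2_cyl_sections_snd[OF g] by eventually_elim (use indicator_mult_power2_le T in auto)
  qed
  show "(trace_int T L g \<tau>)\<^sup>2 \<le> L * (LINT x|segm L. (LINT s|segm T. indicat_real {..<\<tau>} s * g (s, x))\<^sup>2)"
    unfolding trace_int_def using segm.L2_integral_power2_le[OF L2] L by simp
  show "integrable (segm L) (\<lambda>x. (LINT s|segm T. indicat_real {..<\<tau>} s * g (s, x))\<^sup>2)"
    by (rule L2_spaceD(2)[OF L2])
qed

text \<open>The boundary value at \<open>L\<close> of the test function as a difference of two
  traces, valid at every \<open>t\<close>; this is why twice the supremum bounds it.\<close>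

lemma back_int_trace_int:
  assumes g: "g \<in> L2_space (cyl T L)"
  shows "(LINT x|segm L. back_int T \<tau> g (t, x)) = (if t < \<tau> then trace_int T L g \<tau> - trace_int T L g t else 0)"
proof (cases "t < \<tau>")
  case True
  note int = integral_cyl_snd(2)[OF integrable_indicator_cyl[OF g]]
  have m: "(\<lambda>x. back_int T \<tau> g (t, x)) \<in> borel_measurable (segm L)"
  proof -
    note [measurable] = L2_spaceD(1)[OF g, unfolded cyl_def]
    show ?thesis
      unfolding back_int_def indicator_greaterThanLessThan_if fst_conv snd_conv by measurable
  qed
  have "(LINT x|segm L. back_int T \<tau> g (t, x)) = (LINT x|segm L.
      (LINT s|segm T. indicat_real {..<\<tau>} s * g (s, x)) - (LINT s|segm T. indicat_real {..<t} s * g (s, x)))"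
  proof (rule integral_cong_AE[OF m])
    show "AE x in segm L. back_int T \<tau> g (t, x) =
      (LINT s|segm T. indicat_real {..<\<tau>} s * g (s, x)) - (LINT s|segm T. indicat_real {..<t} s * g (s, x))"
      using L2_cyl_sections_snd[OF g]
    proof eventually_elim
      case (elim x)
      have h: "integrable (segm T) (\<lambda>s. indicat_real {..<\<tau>} s * g (s, x))"
        by (intro integrable_indicator_mult segm.L2_space_integrable[OF elim] measurable_segm_id) simp
      have "back_int T \<tau> g (t, x) = (LINT s|segm T. indicat_real {t<..} s * (indicat_real {..<\<tau>} s * g (s, x)))"
        unfolding back_int_def by (intro Bochner_Integration.integral_cong) (auto simp: indicator_def)
      also have "\<dots> = (LINT s|segm T. indicat_real {..<\<tau>} s * g (s, x)) - prim T (\<lambda>s. indicat_real {..<\<tau>} s * g (s, x)) t"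
        by (rule prim_complement[OF h])
      also have "prim T (\<lambda>s. indicat_real {..<\<tau>} s * g (s, x)) t = (LINT s|segm T. indicat_real {..<t} s * g (s, x))"
        unfolding prim_def using True by (intro Bochner_Integration.integral_cong) (auto simp: indicator_def)
      finally show ?case .
    qed
  qed (use int in simp)
  also have "\<dots> = trace_int T L g \<tau> - trace_int T L g t"
    unfolding trace_int_def using int by simp
  finally show ?thesis using True by simp
qed (simp add: back_int_def)

section \<open>The energy identity and the L1 estimate\<close>

lemma integral_weak_form:
  assumes "ux \<in> L2_space (cyl T L)" "qt \<in> L2_space (cyl T L)" "px \<in> L2_space (cyl T L)"
    "qx \<in> L2_space (cyl T L)" "\<psi> \<in> L2_space (segm T)" "b \<in> L2_space (segm T)"
  shows "(LINT t|segm T. - (LINT x|segm L. ux (t, x) * qt (t, x))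
        + k * (LINT x|segm L. px (t, x) * qx (t, x)) + \<psi> t * b t) =
      - (LINT z|cyl T L. ux z * qt z) + k * (LINT z|cyl T L. px z * qx z) + (LINT t|segm T. \<psi> t * b t)"
  using integral_cyl[OF L2_space_mult_integrable[OF assms(1,2)]]
    integral_cyl[OF L2_space_mult_integrable[OF assms(3,4)]] L2_space_mult_integrable[OF assms(5,6)]
  by simp

text \<open>\<open>b \<tau> t\<close> is the value of the test function at \<open>x = L\<close>,
  written as the integral of its \<open>x\<close>-derivative because it vanishes at
  \<open>x = 0\<close>. Its square integrability makes it admissible in the weak equation and the
  boundary product integrable.\<close>

lemma energy_identity:
  assumes T: "0 < T" and L: "0 < L" and H: "0 < H"
    and \<psi>: "\<psi> \<in> L2_space (segm T)"
    and p: "L2_V0 T L p px" and ux: "ux \<in> L2_space (cyl T L)"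
    and ell: "AE z in cyl T L. H * ux z = p z"
    and eq: "\<And>q qx qt b. H1_V0_final_zero T L q qx qt \<Longrightarrow> b \<in> L2_space (segm T) \<Longrightarrow>
           (AE t in segm T. boundary_value L (\<lambda>x. q (t, x)) L (b t)) \<Longrightarrow>
           (LINT t|segm T. - (LINT x|segm L. ux (t, x) * qt (t, x))
                           + k * (LINT x|segm L. px (t, x) * qx (t, x))
                           + \<psi> t * b t) = 0"
  defines "b \<equiv> \<lambda>\<tau> t. LINT x|segm L. back_int T \<tau> px (t, x)"
  shows "(LINT z|cyl T L. indicat_real {..<\<tau>} (fst z) * (p z)\<^sup>2) / H
     + k * (LINT x|segm L. (LINT s|segm T. indicat_real {..<\<tau>} s * px (s, x))\<^sup>2) / 2
     = - (LINT t|segm T. \<psi> t * b \<tau> t)"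
    and "b \<tau> \<in> L2_space (segm T)"
proof -
  let ?qx = "back_int T \<tau> px" and ?qt = "test_t L \<tau> px"
  have pL2: "p \<in> L2_space (cyl T L)" and g: "px \<in> L2_space (cyl T L)"
    and pc: "AE z in cyl T L. p z = cprim L px z"
    using p by (auto simp: L2_V0_iff[OF L])
  note qx = back_int_L2_space[OF g T, of \<tau>]
  have adm: "H1_V0_final_zero T L (cprim L ?qx) ?qx ?qt"
    by (rule test_function_admissible[OF g T L])
  have V0: "AE t in segm T. V0_deriv L (\<lambda>x. cprim L ?qx (t, x)) (\<lambda>x. ?qx (t, x))"
    using adm by (simp add: H1_V0_final_zero_def L2_V0_def)
  have qt: "?qt \<in> L2_space (cyl T L)"
    using adm by (auto simp: H1_V0_final_zero_def L2_V0_def)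
  show bL2: "b \<tau> \<in> L2_space (segm T)"
  proof (rule L2_spaceI)
    show "b \<tau> \<in> borel_measurable (segm T)"
      unfolding b_def by (rule borel_measurable_integrable[OF integral_cyl(2)[OF cyl.L2_space_integrable[OF qx]]])
    show "integrable (segm T) (\<lambda>t. L * (LINT x|segm L. (?qx (t, x))\<^sup>2))"
      using integral_cyl(2)[OF L2_spaceD(2)[OF qx]] by simp
    show "AE t in segm T. (b \<tau> t)\<^sup>2 \<le> L * (LINT x|segm L. (?qx (t, x))\<^sup>2)"
      using L2_cyl_sections[OF qx]
      by eventually_elim (use segm.L2_integral_power2_le L in \<open>fastforce simp: b_def\<close>)
  qed
  \<comment> \<open>The trace of a V0 function at \<open>L\<close> is the integral of its
    derivative, which is how \<open>b\<close> was defined.\<close>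
  have bv: "AE t in segm T. boundary_value L (\<lambda>x. cprim L ?qx (t, x)) L (b \<tau> t)"
    using V0 by eventually_elim (auto simp: b_def intro: V0_boundary_value L)
  note i1 = L2_space_mult_integrable[OF ux qt] and i2 = L2_space_mult_integrable[OF g qx]
  have weak: "- (LINT z|cyl T L. ux z * ?qt z) + k * (LINT z|cyl T L. px z * ?qx z)
      + (LINT t|segm T. \<psi> t * b \<tau> t) = 0"
    using eq[OF adm bL2 bv] unfolding integral_weak_form[OF ux qt g qx \<psi> bL2] .
  have "(LINT z|cyl T L. ux z * ?qt z) = (LINT z|cyl T L. - (indicat_real {..<\<tau>} (fst z) * (p z)\<^sup>2 / H))"
  proof (rule integral_cong_AE)
    show "(\<lambda>z. ux z * ?qt z) \<in> borel_measurable (cyl T L)" using i1 by (rule borel_measurable_integrable)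
    note [measurable] = L2_spaceD(1)[OF pL2, unfolded cyl_def]
    show "(\<lambda>z. - (indicat_real {..<\<tau>} (fst z) * (p z)\<^sup>2 / H)) \<in> borel_measurable (cyl T L)"
      unfolding cyl_def by measurable
    show "AE z in cyl T L. ux z * ?qt z = - (indicat_real {..<\<tau>} (fst z) * (p z)\<^sup>2 / H)"
      using ell pc
    proof eventually_elim
      case (elim z)
      then have "ux z = p z / H" using H by (simp add: field_simps)
      with elim(2) show ?case by (simp add: test_t_def power2_eq_square)
    qed
  qed
  then have A: "(LINT z|cyl T L. ux z * ?qt z) = - (LINT z|cyl T L. indicat_real {..<\<tau>} (fst z) * (p z)\<^sup>2) / H"
    by simp
  have "(LINT z|cyl T L. px z * ?qx z) = (LINT x|segm L. LINT t|segm T. px (t, x) * ?qx (t, x))"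
    using integral_cyl_snd(1)[OF i2] by simp
  also have "\<dots> = (LINT x|segm L. (LINT s|segm T. indicat_real {..<\<tau>} s * px (s, x))\<^sup>2 / 2)"
  proof (rule integral_cong_AE)
    show "(\<lambda>x. LINT t|segm T. px (t, x) * ?qx (t, x)) \<in> borel_measurable (segm L)"
      using integral_cyl_snd(2)[OF i2] by (rule borel_measurable_integrable)
    show "(\<lambda>x. (LINT s|segm T. indicat_real {..<\<tau>} s * px (s, x))\<^sup>2 / 2) \<in> borel_measurable (segm L)"
      using borel_measurable_integrable[OF trace_int_power2_le(2)[OF g T L, of \<tau>]] by measurable
    show "AE x in segm L. (LINT t|segm T. px (t, x) * ?qx (t, x)) =
        (LINT s|segm T. indicat_real {..<\<tau>} s * px (s, x))\<^sup>2 / 2"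
      using L2_cyl_sections_snd[OF g]
    proof eventually_elim
      case (elim x)
      let ?h = "\<lambda>s. indicat_real {..<\<tau>} s * px (s, x)"
      have h: "integrable (segm T) ?h"
        by (intro integrable_indicator_mult segm.L2_space_integrable[OF elim] measurable_segm_id) simp
      \<comment> \<open>For \<open>t < \<tau>\<close> the second indicator truncates the integral at
        \<open>\<tau>\<close>; for later \<open>t\<close> both sides are zero. This brings the
        product into the form of \<open>integral_triangle\<close>.\<close>
      have "px (t, x) * ?qx (t, x) = ?h t * (LINT s|segm T. indicat_real {t<..} s * ?h s)" for t
      proof (cases "t < \<tau>")
        case True
        have "(\<lambda>s. indicat_real {t<..} s * ?h s) = (\<lambda>s. indicat_real {t<..<\<tau>} s * px (s, x))"
          by (auto simp: indicator_def)
        then show ?thesis using True by (simp add: back_int_def)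
      qed (simp add: back_int_def)
      then show ?case by (simp only: integral_triangle[OF h])
    qed
  qed
  finally have B: "(LINT z|cyl T L. px z * ?qx z) = (LINT x|segm L. (LINT s|segm T. indicat_real {..<\<tau>} s * px (s, x))\<^sup>2) / 2"
    by simp
  show "(LINT z|cyl T L. indicat_real {..<\<tau>} (fst z) * (p z)\<^sup>2) / H
     + k * (LINT x|segm L. (LINT s|segm T. indicat_real {..<\<tau>} s * px (s, x))\<^sup>2) / 2
     = - (LINT t|segm T. \<psi> t * b \<tau> t)"
    using weak unfolding A B by simp
qed

text \<open>The inequality \<open>bound\<close> is used twice. Dropping its first term gives
  \<open>M \<le> 4 * L / k * ?N\<close>; dropping the second one at \<open>\<tau> = T\<close> then
  gives the constant \<open>2 * (4 * L / k)\<close>, times \<open>H\<close> from clearing the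
  denominator. The estimate for \<open>u\<close> is the Poincare inequality combined with
  \<open>ux = p / H\<close>.\<close>

lemma weak_state_estimate:
  assumes T: "0 < T" and L: "0 < L" and H: "0 < H" and k: "0 < k"
    and \<psi>: "\<psi> \<in> L2_space (segm T)" and ws: "weak_state T L H k \<psi> u p"
  shows "(LINT z|cyl T L. (p z)\<^sup>2) \<le> 8 * H * L / k * (L1_norm (segm T) \<psi>)\<^sup>2"
    and "(LINT z|cyl T L. (u z)\<^sup>2) \<le> L\<^sup>2 / H\<^sup>2 * (LINT z|cyl T L. (p z)\<^sup>2)"
proof -
  obtain ux px where u: "L2_V0 T L u ux" and p: "L2_V0 T L p px"
    and ell: "\<And>v vx. V0_deriv L v vx \<Longrightarrow>
           (AE t in segm T. (LINT x|segm L. (H * ux (t, x) - p (t, x)) * vx x) = 0)"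
    and weak: "\<And>q qx qt b. H1_V0_final_zero T L q qx qt \<Longrightarrow> b \<in> L2_space (segm T) \<Longrightarrow>
           (AE t in segm T. boundary_value L (\<lambda>x. q (t, x)) L (b t)) \<Longrightarrow>
           (LINT t|segm T. - (LINT x|segm L. ux (t, x) * qt (t, x))
                           + k * (LINT x|segm L. px (t, x) * qx (t, x))
                           + \<psi> t * b t) = 0"
    using ws unfolding weak_state_def by blast
  have pL2: "p \<in> L2_space (cyl T L)" and g: "px \<in> L2_space (cyl T L)" and ux: "ux \<in> L2_space (cyl T L)"
    using p u by (auto simp: L2_V0_def)
  have pt: "AE z in cyl T L. H * ux z = p z" by (rule elliptic_pointwise[OF L ux pL2 ell])
  note energy = energy_identity[OF T L H \<psi> p ux pt weak]
  let ?N = "L1_norm (segm T) \<psi>" and ?b = "\<lambda>\<tau> t. LINT x|segm L. back_int T \<tau> px (t, x)"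
  let ?E = "\<lambda>\<tau>. LINT x|segm L. (LINT s|segm T. indicat_real {..<\<tau>} s * px (s, x))\<^sup>2"
  let ?P = "\<lambda>\<tau>. LINT z|cyl T L. indicat_real {..<\<tau>} (fst z) * (p z)\<^sup>2"
  define M where "M = (SUP \<tau>. \<bar>trace_int T L px \<tau>\<bar>)"
  have bdd: "bdd_above (range (\<lambda>\<tau>. \<bar>trace_int T L px \<tau>\<bar>))"
    using abs_trace_int_le[OF g] by (intro bdd_aboveI2) auto
  have M: "\<bar>trace_int T L px \<tau>\<bar> \<le> M" for \<tau>
    unfolding M_def by (rule cSUP_upper[OF _ bdd]) simp
  have M0: "0 \<le> M" using M[of 0] by linarith
  have rhs: "- (LINT t|segm T. \<psi> t * ?b \<tau> t) \<le> 2 * M * ?N" for \<tau>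
  proof -
    \<comment> \<open>The boundary value is a difference of two traces or zero.\<close>
    have ib: "\<bar>?b \<tau> t\<bar> \<le> 2 * M" for t
      using M[of \<tau>] M[of t] by (auto simp: back_int_trace_int[OF g] M0)
    note int = L2_space_mult_integrable[OF \<psi> energy(2)]
    have "- (LINT t|segm T. \<psi> t * ?b \<tau> t) \<le> \<bar>LINT t|segm T. \<psi> t * ?b \<tau> t\<bar>" by simp
    also have "\<dots> \<le> (LINT t|segm T. \<bar>\<psi> t * ?b \<tau> t\<bar>)" by (rule integral_abs_bound)
    also have "\<dots> \<le> (LINT t|segm T. 2 * M * \<bar>\<psi> t\<bar>)"
    proof (rule integral_mono)
      show "integrable (segm T) (\<lambda>t. 2 * M * \<bar>\<psi> t\<bar>)"
        using segm.L2_space_integrable[OF \<psi>] by simp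
      show "\<bar>\<psi> t * ?b \<tau> t\<bar> \<le> 2 * M * \<bar>\<psi> t\<bar>" for t
        using mult_left_mono[OF ib, of "\<bar>\<psi> t\<bar>" t] by (simp add: abs_mult mult.commute)
    qed (use int in simp)
    finally show ?thesis by (simp add: L1_norm_def)
  qed
  have P0: "0 \<le> ?P \<tau>" and E0: "0 \<le> ?E \<tau>" for \<tau> by simp_all
  have bound: "?P \<tau> / H + k * ?E \<tau> / 2 \<le> 2 * M * ?N" for \<tau>
    using energy(1)[where \<tau>=\<tau>] rhs[of \<tau>] by simp
  have "\<bar>trace_int T L px \<tau>\<bar> \<le> sqrt (4 * L / k * ?N * M)" for \<tau>
  proof -
    have "k * ?E \<tau> / 2 \<le> 2 * M * ?N" using bound[of \<tau>] divide_nonneg_pos[OF P0[of \<tau>] H] by linarith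
    then have "L * ?E \<tau> \<le> 4 * L / k * ?N * M"
      using k L by (simp add: field_simps)
    with trace_int_power2_le(1)[OF g T L, of \<tau>] have "(trace_int T L px \<tau>)\<^sup>2 \<le> 4 * L / k * ?N * M" by linarith
    then have "sqrt ((trace_int T L px \<tau>)\<^sup>2) \<le> sqrt (4 * L / k * ?N * M)" by (rule real_sqrt_le_mono)
    then show ?thesis by simp
  qed
  \<comment> \<open>The right side is independent of \<open>\<tau>\<close>, so it bounds the
    supremum; now \<open>M\<close> stands on both sides.\<close>
  then have "M \<le> sqrt (4 * L / k * ?N * M)"
    unfolding M_def by (intro cSUP_least) auto
  then have "M\<^sup>2 \<le> (sqrt (4 * L / k * ?N * M))\<^sup>2" using M0 by (rule power_mono)
  also have "\<dots> = 4 * L / k * ?N * M" using L k M0 L1_norm_nonneg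
    by (intro real_sqrt_pow2 mult_nonneg_nonneg divide_nonneg_pos) auto
  finally have "M * M \<le> 4 * L / k * ?N * M" by (simp add: power2_eq_square)
  moreover have "0 \<le> 4 * L / k * ?N"
    using L k by (intro mult_nonneg_nonneg divide_nonneg_pos L1_norm_nonneg) auto
  \<comment> \<open>A factor \<open>M\<close> cancels if it is positive; for \<open>M = 0\<close>
    the nonnegative right side suffices.\<close>
  ultimately have M_le: "M \<le> 4 * L / k * ?N"
    using M0 by (metis mult_le_cancel_right order_le_less not_less)
  \<comment> \<open>All times in the cylinder are below \<open>T\<close>, so at
    \<open>\<tau> = T\<close> the indicator is 1.\<close>
  have "(LINT z|cyl T L. (p z)\<^sup>2) = ?P T"
    by (intro Bochner_Integration.integral_cong) (auto simp: space_cyl)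
  moreover have "?P T / H \<le> 2 * (4 * L / k * ?N) * ?N"
  proof -
    have "?P T / H \<le> 2 * M * ?N"
      using bound[of T] mult_nonneg_nonneg[OF less_imp_le[OF k] E0[of T]] by linarith
    also have "\<dots> \<le> 2 * (4 * L / k * ?N) * ?N"
      using M_le L1_norm_nonneg by (intro mult_right_mono mult_left_mono) auto
    finally show ?thesis .
  qed
  ultimately have "(LINT z|cyl T L. (p z)\<^sup>2) / H \<le> 2 * (4 * L / k * ?N) * ?N" by (simp only:)
  then show "(LINT z|cyl T L. (p z)\<^sup>2) \<le> 8 * H * L / k * ?N\<^sup>2"
    using H by (simp add: field_simps power2_eq_square)
  have uc: "AE z in cyl T L. (u z)\<^sup>2 = (cprim L ux z)\<^sup>2"
    using u unfolding L2_V0_iff[OF L] by (auto elim: eventually_mono)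
  have uL2: "u \<in> L2_space (cyl T L)" using u by (auto simp: L2_V0_def)
  have "(LINT z|cyl T L. (u z)\<^sup>2) = (LINT z|cyl T L. (cprim L ux z)\<^sup>2)"
    by (rule integral_cong_AE[OF _ _ uc])
      (use L2_spaceD(2)[OF uL2] L2_spaceD(2)[OF cprim_L2_space(1)[OF ux L]] in \<open>auto intro: borel_measurable_integrable\<close>)
  also have "\<dots> \<le> L\<^sup>2 * (LINT z|cyl T L. (ux z)\<^sup>2)" by (rule cprim_L2_space(2)[OF ux L])
  also have "(LINT z|cyl T L. (ux z)\<^sup>2) = (LINT z|cyl T L. (p z)\<^sup>2 / H\<^sup>2)"
  proof (rule integral_cong_AE)
    show "AE z in cyl T L. (ux z)\<^sup>2 = (p z)\<^sup>2 / H\<^sup>2"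
      using pt
    proof eventually_elim
      case (elim z)
      then have "ux z = p z / H" using H by (simp add: field_simps)
      then show ?case by (simp add: power_divide)
    qed
  qed (use L2_spaceD(2)[OF ux] L2_spaceD(2)[OF pL2] in auto)
  finally show "(LINT z|cyl T L. (u z)\<^sup>2) \<le> L\<^sup>2 / H\<^sup>2 * (LINT z|cyl T L. (p z)\<^sup>2)" by simp
qed

section \<open>Linearity of the control-to-state map and the quadratic cost\<close>

lemma weak_state_lincomb:
  assumes L: "0 < L" and \<psi>: "\<psi>1 \<in> L2_space (segm T)" "\<psi>2 \<in> L2_space (segm T)"
    and ws1: "weak_state T L H k \<psi>1 u1 p1" and ws2: "weak_state T L H k \<psi>2 u2 p2"
  shows "weak_state T L H k (\<lambda>t. a * \<psi>1 t + b * \<psi>2 t) (\<lambda>z. a * u1 z + b * u2 z) (\<lambda>z. a * p1 z + b * p2 z)"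
proof -
  obtain ux1 px1 where u1: "L2_V0 T L u1 ux1" and p1: "L2_V0 T L p1 px1"
    and ell1: "\<And>v vx. V0_deriv L v vx \<Longrightarrow>
           (AE t in segm T. (LINT x|segm L. (H * ux1 (t, x) - p1 (t, x)) * vx x) = 0)"
    and weak1: "\<And>q qx qt b. H1_V0_final_zero T L q qx qt \<Longrightarrow> b \<in> L2_space (segm T) \<Longrightarrow>
           (AE t in segm T. boundary_value L (\<lambda>x. q (t, x)) L (b t)) \<Longrightarrow>
           (LINT t|segm T. - (LINT x|segm L. ux1 (t, x) * qt (t, x))
                           + k * (LINT x|segm L. px1 (t, x) * qx (t, x))
                           + \<psi>1 t * b t) = 0"
    using ws1 unfolding weak_state_def by blast
  obtain ux2 px2 where u2: "L2_V0 T L u2 ux2" and p2: "L2_V0 T L p2 px2"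
    and ell2: "\<And>v vx. V0_deriv L v vx \<Longrightarrow>
           (AE t in segm T. (LINT x|segm L. (H * ux2 (t, x) - p2 (t, x)) * vx x) = 0)"
    and weak2: "\<And>q qx qt b. H1_V0_final_zero T L q qx qt \<Longrightarrow> b \<in> L2_space (segm T) \<Longrightarrow>
           (AE t in segm T. boundary_value L (\<lambda>x. q (t, x)) L (b t)) \<Longrightarrow>
           (LINT t|segm T. - (LINT x|segm L. ux2 (t, x) * qt (t, x))
                           + k * (LINT x|segm L. px2 (t, x) * qx (t, x))
                           + \<psi>2 t * b t) = 0"
    using ws2 unfolding weak_state_def by blast
  have L2: "ux1 \<in> L2_space (cyl T L)" "ux2 \<in> L2_space (cyl T L)" "px1 \<in> L2_space (cyl T L)"
    "px2 \<in> L2_space (cyl T L)" "p1 \<in> L2_space (cyl T L)" "p2 \<in> L2_space (cyl T L)"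
    using u1 u2 p1 p2 by (auto simp: L2_V0_def)
  let ?ux = "\<lambda>z. a * ux1 z + b * ux2 z" and ?px = "\<lambda>z. a * px1 z + b * px2 z"
    and ?p = "\<lambda>z. a * p1 z + b * p2 z" and ?\<psi> = "\<lambda>t. a * \<psi>1 t + b * \<psi>2 t"
  show ?thesis
    unfolding weak_state_def
  proof (intro exI conjI allI impI)
    show "L2_V0 T L (\<lambda>z. a * u1 z + b * u2 z) ?ux" "L2_V0 T L ?p ?px"
      by (intro L2_V0_lincomb L u1 u2 p1 p2)+
  next
    fix v vx assume v: "V0_deriv L v vx"
    then have vx: "vx \<in> L2_space (segm L)" by (simp add: V0_deriv_def H1_deriv_def)
    \<comment> \<open>The inner integral may be split only where the sections are integrable, which
      holds for almost every \<open>t\<close>.\<close>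
    have *: "AE t in segm T. integrable (segm L) (\<lambda>x. (H * f (t, x) - g (t, x)) * vx x)"
      if "f \<in> L2_space (cyl T L)" "g \<in> L2_space (cyl T L)" for f g
      using L2_cyl_sections[OF that(1)] L2_cyl_sections[OF that(2)]
      by eventually_elim (intro L2_space_mult_integrable L2_space_diff L2_space_cmult vx)
    from ell1[OF v] ell2[OF v] *[OF L2(1,5)] *[OF L2(2,6)]
    show "AE t in segm T. (LINT x|segm L. (H * ?ux (t, x) - ?p (t, x)) * vx x) = 0"
    proof eventually_elim
      case (elim t)
      have "(\<lambda>x. (H * ?ux (t, x) - ?p (t, x)) * vx x) =
          (\<lambda>x. a * ((H * ux1 (t, x) - p1 (t, x)) * vx x) + b * ((H * ux2 (t, x) - p2 (t, x)) * vx x))"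
        by (auto simp: algebra_simps)
      with elim show ?case by simp
    qed
  next
    fix q qx qt c
    assume "H1_V0_final_zero T L q qx qt \<and> c \<in> L2_space (segm T) \<and>
      (AE t in segm T. boundary_value L (\<lambda>x. q (t, x)) L (c t))"
    then have q: "H1_V0_final_zero T L q qx qt" and c: "c \<in> L2_space (segm T)"
      and bv: "AE t in segm T. boundary_value L (\<lambda>x. q (t, x)) L (c t)" by auto
    have qL2: "qx \<in> L2_space (cyl T L)" "qt \<in> L2_space (cyl T L)"
      using q by (auto simp: H1_V0_final_zero_def L2_V0_def)
    have lin: "(LINT z|M. (a * f z + b * g z) * h z) = a * (LINT z|M. f z * h z) + b * (LINT z|M. g z * h z)"
      if "f \<in> L2_space M" "g \<in> L2_space M" "h \<in> L2_space M" for f g h and M :: "'m measure"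
      using L2_space_mult_integrable[OF that(1,3)] L2_space_mult_integrable[OF that(2,3)]
      by (simp add: distrib_right mult.assoc)
    note w1 = weak1[OF q c bv, unfolded integral_weak_form[OF L2(1) qL2(2) L2(3) qL2(1) \<psi>(1) c]]
    note w2 = weak2[OF q c bv, unfolded integral_weak_form[OF L2(2) qL2(2) L2(4) qL2(1) \<psi>(2) c]]
    have "?ux \<in> L2_space (cyl T L)" "?px \<in> L2_space (cyl T L)" "?\<psi> \<in> L2_space (segm T)"
      by (intro L2_space_add L2_space_cmult L2 \<psi>)+
    from integral_weak_form[OF this(1) qL2(2) this(2) qL2(1) this(3) c]
    have "(LINT t|segm T. - (LINT x|segm L. ?ux (t, x) * qt (t, x))
                           + k * (LINT x|segm L. ?px (t, x) * qx (t, x)) + ?\<psi> t * c t) =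
       - (LINT z|cyl T L. ?ux z * qt z) + k * (LINT z|cyl T L. ?px z * qx z) + (LINT t|segm T. ?\<psi> t * c t)" .
    also have "\<dots> = a * (- (LINT z|cyl T L. ux1 z * qt z) + k * (LINT z|cyl T L. px1 z * qx z) + (LINT t|segm T. \<psi>1 t * c t))
      + b * (- (LINT z|cyl T L. ux2 z * qt z) + k * (LINT z|cyl T L. px2 z * qx z) + (LINT t|segm T. \<psi>2 t * c t))"
      unfolding lin[OF L2(1,2) qL2(2)] lin[OF L2(3,4) qL2(1)] lin[OF \<psi> c]
      by (simp only: algebra_simps)
    also have "\<dots> = 0" by (simp only: w1 w2 mult_zero_right add_0)
    finally show "(LINT t|segm T. - (LINT x|segm L. ?ux (t, x) * qt (t, x))
                           + k * (LINT x|segm L. ?px (t, x) * qx (t, x)) + ?\<psi> t * c t) = 0" .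
  qed
qed

text \<open>The difference of the two candidates is a weak state for the control zero, and the
  energy estimate makes its norms vanish. This is the sense in which a map that merely selects weak
  states is linear.\<close>

lemma weak_state_unique_lincomb:
  assumes T: "0 < T" and L: "0 < L" and H: "0 < H" and k: "0 < k"
    and f: "f \<in> L2_space (segm T)" and g: "g \<in> L2_space (segm T)"
    and wf: "weak_state T L H k f uf pf" and wg: "weak_state T L H k g ug pg"
    and w: "weak_state T L H k (\<lambda>t. a * f t + b * g t) u p"
  shows "AE z in cyl T L. u z = a * uf z + b * ug z" and "AE z in cyl T L. p z = a * pf z + b * pg z"
proof -
  have fg: "(\<lambda>t. a * f t + b * g t) \<in> L2_space (segm T)"
    by (intro L2_space_add L2_space_cmult f g)
  let ?u = "\<lambda>z. 1 * u z + (-1) * (a * uf z + b * ug z)" and ?p = "\<lambda>z. 1 * p z + (-1) * (a * pf z + b * pg z)"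
  have zero: "weak_state T L H k (\<lambda>_. 0) ?u ?p"
    using weak_state_lincomb[OF L fg fg w weak_state_lincomb[OF L f g wf wg, of a b], of 1 "-1"] by simp
  have L2: "?u \<in> L2_space (cyl T L)" "?p \<in> L2_space (cyl T L)"
    using zero unfolding weak_state_def L2_V0_def by blast+
  note est = weak_state_estimate[OF T L H k segm.L2_space_const zero]
  have p0: "(LINT z|cyl T L. (?p z)\<^sup>2) = 0"
    using est(1) by (intro antisym) (simp_all add: L1_norm_def)
  then have u0: "(LINT z|cyl T L. (?u z)\<^sup>2) = 0"
    using est(2) by (intro antisym) simp_all
  have "AE z in cyl T L. (?p z)\<^sup>2 = 0" "AE z in cyl T L. (?u z)\<^sup>2 = 0"
    using p0 u0 integral_nonneg_eq_0_iff_AE[OF L2_spaceD(2)[OF L2(2)]]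
      integral_nonneg_eq_0_iff_AE[OF L2_spaceD(2)[OF L2(1)]] by simp_all
  then show "AE z in cyl T L. u z = a * uf z + b * ug z" "AE z in cyl T L. p z = a * pf z + b * pg z"
    by (eventually_elim, simp)+
qed

section \<open>Derivatives of quadratic functionals on L2\<close>

lemma L2_functional_add:
  assumes "L2_functional M D" and "L2_functional M E"
  shows "L2_functional M (\<lambda>f. D f + E f)"
proof -
  obtain B C where B: "\<And>f. f \<in> L2_space M \<Longrightarrow> \<bar>D f\<bar> \<le> B * L2_norm M f"
    and C: "\<And>f. f \<in> L2_space M \<Longrightarrow> \<bar>E f\<bar> \<le> C * L2_norm M f"
    using assms unfolding L2_functional_def by metis
  have "\<bar>D f + E f\<bar> \<le> (B + C) * L2_norm M f" if "f \<in> L2_space M" for f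
    using B[OF that] C[OF that] by (simp add: distrib_right)
  then have "\<exists>B. \<forall>f\<in>L2_space M. \<bar>D f + E f\<bar> \<le> B * L2_norm M f" by blast
  with assms show ?thesis unfolding L2_functional_def by (simp add: algebra_simps)
qed

lemma L2_bilinear_form_add:
  assumes "L2_bilinear_form M H" and "L2_bilinear_form M K"
  shows "L2_bilinear_form M (\<lambda>f g. H f g + K f g)"
proof -
  obtain B C where B: "\<And>f g. f \<in> L2_space M \<Longrightarrow> g \<in> L2_space M \<Longrightarrow> \<bar>H f g\<bar> \<le> B * L2_norm M f * L2_norm M g"
    and C: "\<And>f g. f \<in> L2_space M \<Longrightarrow> g \<in> L2_space M \<Longrightarrow> \<bar>K f g\<bar> \<le> C * L2_norm M f * L2_norm M g"
    using assms unfolding L2_bilinear_form_def by metis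
  have "\<bar>H f g + K f g\<bar> \<le> (B + C) * L2_norm M f * L2_norm M g"
    if "f \<in> L2_space M" "g \<in> L2_space M" for f g
    using abs_triangle_ineq[of "H f g" "K f g"] B[OF that] C[OF that]
    unfolding distrib_right by linarith
  then have "\<exists>B. \<forall>f\<in>L2_space M. \<forall>g\<in>L2_space M. \<bar>H f g + K f g\<bar> \<le> B * L2_norm M f * L2_norm M g"
    by blast
  with assms show ?thesis unfolding L2_bilinear_form_def by (simp add: L2_functional_add)
qed

text \<open>The expansion is exact: the first-order remainder is \<open>H h h / 2\<close>, and the
  derivative is affine in the base point.\<close>

lemma quadratic_twice_L2_derivatives:
  assumes D: "\<And>\<psi>. \<psi> \<in> L2_space M \<Longrightarrow> L2_functional M (D \<psi>)"
    and H: "L2_bilinear_form M H"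
    and J: "\<And>\<psi> h. \<psi> \<in> L2_space M \<Longrightarrow> h \<in> L2_space M \<Longrightarrow> J (\<lambda>x. \<psi> x + h x) = J \<psi> + D \<psi> h + H h h / 2"
    and DH: "\<And>\<psi> h g. \<psi> \<in> L2_space M \<Longrightarrow> h \<in> L2_space M \<Longrightarrow> g \<in> L2_space M \<Longrightarrow>
      D (\<lambda>x. \<psi> x + h x) g = D \<psi> g + H h g"
  shows "twice_L2_derivatives M J D (\<lambda>_. H)"
  unfolding twice_L2_derivatives_def
proof (intro ballI conjI)
  fix \<psi> assume \<psi>: "\<psi> \<in> L2_space M"
  obtain B where B: "\<And>f g. f \<in> L2_space M \<Longrightarrow> g \<in> L2_space M \<Longrightarrow> \<bar>H f g\<bar> \<le> B * L2_norm M f * L2_norm M g"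
    using H unfolding L2_bilinear_form_def by metis
  \<comment> \<open>Adding 1 keeps the denominator of the radius positive.\<close>
  have small: "\<bar>H h h / 2\<bar> \<le> e * L2_norm M h"
    if e: "0 < e" and h: "h \<in> L2_space M" "L2_norm M h < e / (\<bar>B\<bar> + 1)" for e h
  proof -
    have "\<bar>H h h\<bar> \<le> B * L2_norm M h * L2_norm M h" by (rule B[OF h(1) h(1)])
    also have "\<dots> \<le> (\<bar>B\<bar> + 1) * L2_norm M h * L2_norm M h"
      by (intro mult_right_mono L2_norm_nonneg) auto
    also have "\<dots> \<le> e * L2_norm M h"
      using h(2) by (intro mult_right_mono L2_norm_nonneg) (simp add: field_simps)
    finally show ?thesis using abs_ge_zero[of "H h h"] by (simp add: abs_divide)
  qed
  show "has_L2_derivative M J (D \<psi>) \<psi>"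
    unfolding has_L2_derivative_def
  proof (intro conjI allI impI D[OF \<psi>])
    fix e :: real assume "0 < e"
    with small J[OF \<psi>]
    show "\<exists>d>0. \<forall>h\<in>L2_space M. L2_norm M h < d \<longrightarrow> \<bar>J (\<lambda>x. \<psi> x + h x) - J \<psi> - D \<psi> h\<bar> \<le> e * L2_norm M h"
      by (intro exI[of _ "e / (\<bar>B\<bar> + 1)"]) auto
  qed
  show "has_L2_derivative_dual M D H \<psi>"
    unfolding has_L2_derivative_dual_def
    \<comment> \<open>By \<open>DH\<close> the remainder is zero, so any radius serves.\<close>
    using H DH[OF \<psi>] by (auto intro!: exI[of _ 1] mult_nonneg_nonneg L2_norm_nonneg)
qed

text \<open>\<open>S\<close> stands for either component of the control-to-state map and
  \<open>c\<close> for the offset of the remaining data from the target. \<open>S\<close> is linear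
  almost everywhere only, so its linearity is applied under integrals.\<close>

lemma least_squares_expansion:
  fixes S :: "('a \<Rightarrow> real) \<Rightarrow> 'b \<Rightarrow> real"
  assumes S: "\<And>f. f \<in> L2_space M \<Longrightarrow> S f \<in> L2_space N"
    and lin: "\<And>a b f g. f \<in> L2_space M \<Longrightarrow> g \<in> L2_space M \<Longrightarrow>
      AE z in N. S (\<lambda>x. a * f x + b * g x) z = a * S f z + b * S g z"
    and bound: "\<And>f. f \<in> L2_space M \<Longrightarrow> L2_norm N (S f) \<le> B * L2_norm M f"
    and c: "c \<in> L2_space N"
  defines "J \<equiv> \<lambda>\<psi>. (L2_norm N (\<lambda>z. S \<psi> z + c z))\<^sup>2 / 2"
    and "D \<equiv> \<lambda>\<psi> h. LINT z|N. (S \<psi> z + c z) * S h z"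
    and "H \<equiv> \<lambda>f g. LINT z|N. S f z * S g z"
  shows "\<And>\<psi>. \<psi> \<in> L2_space M \<Longrightarrow> L2_functional M (D \<psi>)"
    and "L2_bilinear_form M H"
    and "\<And>\<psi> h. \<psi> \<in> L2_space M \<Longrightarrow> h \<in> L2_space M \<Longrightarrow> J (\<lambda>x. \<psi> x + h x) = J \<psi> + D \<psi> h + H h h / 2"
    and "\<And>\<psi> h g. \<psi> \<in> L2_space M \<Longrightarrow> h \<in> L2_space M \<Longrightarrow> g \<in> L2_space M \<Longrightarrow>
      D (\<lambda>x. \<psi> x + h x) g = D \<psi> g + H h g"
proof -
  have pair: "L2_functional M (\<lambda>h. LINT z|N. w z * S h z)" if w: "w \<in> L2_space N" for w
    unfolding L2_functional_def
  proof (intro conjI ballI allI exI)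
    \<comment> \<open>Additivity is the case \<open>a = b = 1\<close>; homogeneity is the case
      \<open>g = f\<close>, \<open>b = 0\<close>.\<close>
    have comb: "(LINT z|N. w z * S (\<lambda>x. a * f x + b * g x) z) = a * (LINT z|N. w z * S f z) + b * (LINT z|N. w z * S g z)"
      if f: "f \<in> L2_space M" and g: "g \<in> L2_space M" for a b f g
    proof -
      note i = L2_space_mult_integrable[OF w S[OF f]] L2_space_mult_integrable[OF w S[OF g]]
      have fg: "(\<lambda>x. a * f x + b * g x) \<in> L2_space M" by (intro L2_space_add L2_space_cmult f g)
      have "(LINT z|N. w z * S (\<lambda>x. a * f x + b * g x) z) = (LINT z|N. a * (w z * S f z) + b * (w z * S g z))"
      proof (rule integral_cong_AE)
        show "(\<lambda>z. w z * S (\<lambda>x. a * f x + b * g x) z) \<in> borel_measurable N"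
          using L2_space_mult_integrable[OF w S[OF fg]] by (rule borel_measurable_integrable)
        show "AE z in N. w z * S (\<lambda>x. a * f x + b * g x) z = a * (w z * S f z) + b * (w z * S g z)"
          using lin[OF f g, of a b] by eventually_elim (simp add: algebra_simps)
      qed (use i in auto)
      then show ?thesis using i by simp
    qed
    show "(LINT z|N. w z * S (\<lambda>x. f x + g x) z) = (LINT z|N. w z * S f z) + (LINT z|N. w z * S g z)"
      if "f \<in> L2_space M" "g \<in> L2_space M" for f g
      using comb[OF that, of 1 1] by simp
    show "(LINT z|N. w z * S (\<lambda>x. a * f x) z) = a * (LINT z|N. w z * S f z)"
      if "f \<in> L2_space M" for a f
      using comb[OF that that, of a 0] by simp
    show "\<bar>LINT z|N. w z * S f z\<bar> \<le> (L2_norm N w * B) * L2_norm M f" if f: "f \<in> L2_space M" for f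
    proof -
      have "\<bar>LINT z|N. w z * S f z\<bar> \<le> L2_norm N w * L2_norm N (S f)"
        by (rule L2_Cauchy_Schwarz[OF w S[OF f]])
      also have "\<dots> \<le> L2_norm N w * (B * L2_norm M f)"
        by (intro mult_left_mono bound f L2_norm_nonneg)
      finally show ?thesis by (simp add: mult.assoc)
    qed
  qed
  show "L2_functional M (D \<psi>)" if "\<psi> \<in> L2_space M" for \<psi>
    unfolding D_def by (intro pair L2_space_add S that c)
  have sym: "H f g = H g f" for f g by (simp add: H_def mult.commute)
  show "L2_bilinear_form M H"
    unfolding L2_bilinear_form_def
  proof (intro conjI ballI exI)
    show left: "L2_functional M (H f)" if "f \<in> L2_space M" for f
      unfolding H_def by (intro pair S that)
    show "L2_functional M (\<lambda>f. H f g)" if "g \<in> L2_space M" for g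
      unfolding sym[of _ g] by (rule left[OF that])
    show "\<bar>H f g\<bar> \<le> (B * B) * L2_norm M f * L2_norm M g" if f: "f \<in> L2_space M" and g: "g \<in> L2_space M" for f g
    proof -
      have "\<bar>H f g\<bar> \<le> L2_norm N (S f) * L2_norm N (S g)"
        unfolding H_def by (rule L2_Cauchy_Schwarz[OF S[OF f] S[OF g]])
      also have "\<dots> \<le> (B * L2_norm M f) * (B * L2_norm M g)"
        \<comment> \<open>\<open>B * L2_norm M f\<close> dominates a norm and is therefore
          nonnegative, as \<open>mult_mono\<close> requires.\<close>
        using order_trans[OF L2_norm_nonneg bound[OF f]]
        by (intro mult_mono bound f g L2_norm_nonneg)
      finally show ?thesis by (simp add: mult_ac)
    qed
  qed
  have add: "AE z in N. S (\<lambda>x. \<psi> x + h x) z = S \<psi> z + S h z" if "\<psi> \<in> L2_space M" "h \<in> L2_space M" for \<psi> h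
    using lin[OF that, of 1 1] by simp
  show "D (\<lambda>x. \<psi> x + h x) g = D \<psi> g + H h g"
    if \<psi>: "\<psi> \<in> L2_space M" and h: "h \<in> L2_space M" and g: "g \<in> L2_space M" for \<psi> h g
  proof -
    note i = L2_space_mult_integrable[OF L2_space_add[OF S[OF \<psi>] c] S[OF g]] L2_space_mult_integrable[OF S[OF h] S[OF g]]
    have "D (\<lambda>x. \<psi> x + h x) g = (LINT z|N. (S \<psi> z + c z) * S g z + S h z * S g z)"
      unfolding D_def
    proof (rule integral_cong_AE)
      show "(\<lambda>z. (S (\<lambda>x. \<psi> x + h x) z + c z) * S g z) \<in> borel_measurable N"
        by (intro borel_measurable_integrable L2_space_mult_integrable L2_space_add S c \<psi> h g)
      show "AE z in N. (S (\<lambda>x. \<psi> x + h x) z + c z) * S g z = (S \<psi> z + c z) * S g z + S h z * S g z"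
        using add[OF \<psi> h] by eventually_elim (simp add: algebra_simps)
    qed (use i in auto)
    also have "\<dots> = D \<psi> g + H h g" unfolding D_def H_def using i by simp
    finally show ?thesis .
  qed
  show "J (\<lambda>x. \<psi> x + h x) = J \<psi> + D \<psi> h + H h h / 2"
    if \<psi>: "\<psi> \<in> L2_space M" and h: "h \<in> L2_space M" for \<psi> h
  proof -
    note L2 = L2_space_add[OF S[OF \<psi>] c]
    note i = L2_space_mult_integrable[OF L2 S[OF h]] L2_space_mult_integrable[OF L2 L2] L2_space_mult_integrable[OF S[OF h] S[OF h]]
    have L2': "(\<lambda>z. S (\<lambda>x. \<psi> x + h x) z + c z) \<in> L2_space N" by (intro L2_space_add S c \<psi> h)
    have "(LINT z|N. (S (\<lambda>x. \<psi> x + h x) z + c z)\<^sup>2) =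
        (LINT z|N. (S \<psi> z + c z) * (S \<psi> z + c z) + 2 * ((S \<psi> z + c z) * S h z) + S h z * S h z)"
    proof (rule integral_cong_AE)
      show "AE z in N. (S (\<lambda>x. \<psi> x + h x) z + c z)\<^sup>2 =
          (S \<psi> z + c z) * (S \<psi> z + c z) + 2 * ((S \<psi> z + c z) * S h z) + S h z * S h z"
        using add[OF \<psi> h] by eventually_elim (simp add: power2_eq_square algebra_simps)
    qed (use i L2_spaceD(2)[OF L2'] in auto)
    also have "\<dots> = (LINT z|N. (S \<psi> z + c z)\<^sup>2) + 2 * D \<psi> h + H h h"
      unfolding D_def H_def using i by (simp add: power2_eq_square)
    finally show ?thesis by (simp add: J_def L2_norm_power2 add_divide_distrib)
  qed
qed

section \<open>The cost functional of the poroelastic control problem\<close>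

theorem theorem5p5:
  fixes T L lambda_e mu_e k :: real
    and u_d p_d u_til p_til :: "real \<times> real \<Rightarrow> real"
    and G :: "(real \<Rightarrow> real) \<Rightarrow> (real \<times> real \<Rightarrow> real) \<times> (real \<times> real \<Rightarrow> real)"
  assumes "T > 0" and "L > 0" and "lambda_e > 0" and "mu_e > 0" and "k > 0"
    and "u_d \<in> L2_space (cyl T L)" and "p_d \<in> L2_space (cyl T L)"
    and "u_til \<in> L2_space (cyl T L)" and "p_til \<in> L2_space (cyl T L)"
    and "\<And>\<psi>. \<psi> \<in> L2_space (segm T) \<Longrightarrow>
           weak_state T L (lambda_e + 2 * mu_e) k \<psi> (fst (G \<psi>)) (snd (G \<psi>))"
  shows "\<exists>j' j''.
    twice_L2_derivatives (segm T) (cost T L u_d p_d u_til p_til G) j' j'' \<and>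
    (\<exists>C>0. \<forall>\<psi>\<in>L2_space (segm T). \<forall>\<xi>\<in>L2_space (segm T). \<forall>\<phi>\<in>L2_space (segm T).
       \<bar>j'' \<psi> \<xi> \<phi>\<bar> \<le> C * L1_norm (segm T) \<xi> * L1_norm (segm T) \<phi>)"
proof -
  define H where "H = lambda_e + 2 * mu_e"
  have H: "0 < H" using assms by (simp add: H_def)
  note T = \<open>T > 0\<close> and L = \<open>L > 0\<close> and k = \<open>k > 0\<close>
  let ?M = "segm T" and ?N = "cyl T L"
  define U where "U \<psi> = fst (G \<psi>)" for \<psi>
  define P where "P \<psi> = snd (G \<psi>)" for \<psi>
  have ws: "weak_state T L H k \<psi> (U \<psi>) (P \<psi>)" if "\<psi> \<in> L2_space ?M" for \<psi>
    using assms(10)[OF that] by (simp add: U_def P_def H_def)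
  have L2: "U \<psi> \<in> L2_space ?N" "P \<psi> \<in> L2_space ?N" if "\<psi> \<in> L2_space ?M" for \<psi>
    using ws[OF that] unfolding weak_state_def L2_V0_def by blast+
  have lin: "AE z in ?N. U (\<lambda>x. a * f x + b * g x) z = a * U f z + b * U g z"
    "AE z in ?N. P (\<lambda>x. a * f x + b * g x) z = a * P f z + b * P g z"
    if f: "f \<in> L2_space ?M" and g: "g \<in> L2_space ?M" for a b f g
    using weak_state_unique_lincomb[OF T L H k f g ws[OF f] ws[OF g] ws, of a b]
    by (simp_all add: L2_space_add L2_space_cmult f g)
  \<comment> \<open>\<open>CP\<close> is the root of the constant in the estimate for p;
    \<open>CU\<close> carries in addition the Poincare factor \<open>L\<close> and the division by
    \<open>H\<close> from the elliptic equation.\<close>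
  define CP where "CP = sqrt (8 * H * L / k)"
  define CU where "CU = L / H * CP"
  have CP: "0 < CP" and CU: "0 < CU" using H L k by (simp_all add: CP_def CU_def)
  have P_le: "L2_norm ?N (P \<psi>) \<le> CP * L1_norm ?M \<psi>" if "\<psi> \<in> L2_space ?M" for \<psi>
    using real_sqrt_le_mono[OF weak_state_estimate(1)[OF T L H k that ws[OF that]]]
    unfolding real_sqrt_mult[of "8 * H * L / k"] real_sqrt_abs abs_of_nonneg[OF L1_norm_nonneg]
    by (simp only: L2_norm_def CP_def)
  have U_le: "L2_norm ?N (U \<psi>) \<le> CU * L1_norm ?M \<psi>" if "\<psi> \<in> L2_space ?M" for \<psi>
  proof -
    have "L2_norm ?N (U \<psi>) \<le> sqrt (L\<^sup>2 / H\<^sup>2 * (LINT z|?N. (P \<psi> z)\<^sup>2))"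
      unfolding L2_norm_def by (rule real_sqrt_le_mono[OF weak_state_estimate(2)[OF T L H k that ws[OF that]]])
    also have "\<dots> = L / H * L2_norm ?N (P \<psi>)"
      using L H by (simp add: L2_norm_def real_sqrt_mult real_sqrt_divide)
    also have "\<dots> \<le> L / H * (CP * L1_norm ?M \<psi>)"
      using P_le[OF that] L H by (intro mult_left_mono) auto
    finally show ?thesis by (simp add: CU_def)
  qed
  \<comment> \<open>Supplies the L2 boundedness, with constant \<open>C * sqrt T\<close>, that
    \<open>least_squares_expansion\<close> expects.\<close>
  have L1: "C * L1_norm ?M \<psi> \<le> (C * sqrt T) * L2_norm ?M \<psi>" if "0 < C" "\<psi> \<in> L2_space ?M" for C \<psi>
    using mult_left_mono[OF segm.L1_norm_le_L2_norm[OF that(2)], of C] that(1) T by (simp add: mult.assoc)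
  have cU: "(\<lambda>z. u_til z - u_d z) \<in> L2_space ?N" and cP: "(\<lambda>z. p_til z - p_d z) \<in> L2_space ?N"
    using assms by (auto intro: L2_space_diff)
  note EU = least_squares_expansion[of ?M U ?N "CU * sqrt T", OF L2(1) lin(1) order_trans[OF U_le L1[OF CU]] cU]
  note EP = least_squares_expansion[of ?M P ?N "CP * sqrt T", OF L2(2) lin(2) order_trans[OF P_le L1[OF CP]] cP]
  let ?D = "\<lambda>\<psi> h. (LINT z|?N. (U \<psi> z + (u_til z - u_d z)) * U h z) + (LINT z|?N. (P \<psi> z + (p_til z - p_d z)) * P h z)"
  let ?H = "\<lambda>f g. (LINT z|?N. U f z * U g z) + (LINT z|?N. P f z * P g z)"
  have "cost T L u_d p_d u_til p_til G = (\<lambda>\<psi>. (L2_norm ?N (\<lambda>z. U \<psi> z + (u_til z - u_d z)))\<^sup>2 / 2 +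
      (L2_norm ?N (\<lambda>z. P \<psi> z + (p_til z - p_d z)))\<^sup>2 / 2)"
    by (simp add: fun_eq_iff cost_def U_def P_def add_diff_eq)
  moreover have "twice_L2_derivatives ?M (\<lambda>\<psi>. (L2_norm ?N (\<lambda>z. U \<psi> z + (u_til z - u_d z)))\<^sup>2 / 2 +
      (L2_norm ?N (\<lambda>z. P \<psi> z + (p_til z - p_d z)))\<^sup>2 / 2) ?D (\<lambda>_. ?H)"
  proof (rule quadratic_twice_L2_derivatives)
    show "L2_functional ?M (?D \<psi>)" if "\<psi> \<in> L2_space ?M" for \<psi>
      by (intro L2_functional_add EU(1) EP(1) that)
    show "L2_bilinear_form ?M ?H"
      by (intro L2_bilinear_form_add EU(2) EP(2))
  qed (simp_all add: EU(3,4) EP(3,4) add_divide_distrib)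
  moreover have "\<bar>?H \<xi> \<phi>\<bar> \<le> (CU * CU + CP * CP) * L1_norm ?M \<xi> * L1_norm ?M \<phi>"
    if \<xi>: "\<xi> \<in> L2_space ?M" and \<phi>: "\<phi> \<in> L2_space ?M" for \<xi> \<phi>
  proof -
    \<comment> \<open>Cauchy-Schwarz on the cylinder separates the two directions before the L1
      estimate is applied to each of them. Both state components contribute, hence the constant
      \<open>CU * CU + CP * CP\<close>.\<close>
    have "\<bar>LINT z|?N. S \<xi> z * S \<phi> z\<bar> \<le> C * C * (L1_norm ?M \<xi> * L1_norm ?M \<phi>)"
      if S: "\<And>f. f \<in> L2_space ?M \<Longrightarrow> S f \<in> L2_space ?N"
        and le: "\<And>f. f \<in> L2_space ?M \<Longrightarrow> L2_norm ?N (S f) \<le> C * L1_norm ?M f" for S :: "_ \<Rightarrow> _ \<Rightarrow> real" and C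
    proof -
      have "\<bar>LINT z|?N. S \<xi> z * S \<phi> z\<bar> \<le> L2_norm ?N (S \<xi>) * L2_norm ?N (S \<phi>)"
        by (intro L2_Cauchy_Schwarz S \<xi> \<phi>)
      also have "\<dots> \<le> (C * L1_norm ?M \<xi>) * (C * L1_norm ?M \<phi>)"
        using order_trans[OF L2_norm_nonneg le[OF \<xi>]] by (intro mult_mono le \<xi> \<phi> L2_norm_nonneg)
      finally show ?thesis by (simp add: mult_ac)
    qed
    from this[OF L2(1) U_le] this[OF L2(2) P_le] show ?thesis
      by (simp add: algebra_simps)
  qed
  moreover have "0 < CU * CU + CP * CP" using CU CP by (simp add: add_pos_pos)
  ultimately show ?thesis
    by (intro exI[of _ ?D] exI[of _ "\<lambda>_. ?H"] conjI exI[of _ "CU * CU + CP * CP"]) auto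
qed

end
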